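(* The $0$-reachability problem (given a 0-C1PVASS $\mathcal{A}$, decide whether $\mathcal{A}$ has a $0$-reaching run) and the $0$-coverability problem (given a 0-C1PVASS $\mathcal{A}$, decide whether $\mathcal{A}$ has a $0$-covering run) are decidable in polynomial time.
   Context: A C1PVASS is a tuple $\mathcal{A}=(S,\Gamma,\delta,\bot,s_0,f,\ell)$ where $S$ is a finite set of states, $\Gamma$ a finite stack alphabet with $\bot\in\Gamma$, $s_0\in S$ the initial state, $f\in S$ the accepting state, $\ell:S\to\mathbb{N}$ assigns lower-bound guards, and $\delta:S\times S\rightharpoonup \mathbb{Z}\times(\{a,\overline{a}\mid a\in\Gamma\setminus\{\bot\}\}\cup\{\epsilon\})$ is a partial function giving a counter update (an integer, encoded in binary) and a stack operation ($a$ = push $a$, $\overline{a}$ = pop $a$, $\epsilon$ = none). A configuration is $(s,\alpha,c)$ with $\alpha\in\Gamma^*$ (top on the right), $c\in\mathbb{R}_{\ge0}$, $c\ge\ell(s)$; the initial configuration is $(s_0,\bot,0)$. A run is a sequence $q_0\dots q_n$, $q_i=(s_i,\alpha_i,c_i)$, with $q_0$ initial, such that for each $i<n$, $\delta(s_i,s_{i+1})=(z,op)$ is defined, the stack changes according to $op$ (unchanged, push, or pop of the top symbol), and $c_{i+1}=c_i+\gamma_i z$ for some $\gamma_i\in(0,1]$. A run is $k$-reaching if $s_n=f$ and $c_n=k$, and $k$-covering if $s_n=f$ and $c_n\ge k$. A 0-C1PVASS is a C1PVASS with $\ell\equiv 0$. *)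

theory Defs
  imports Complex_Main "HOL-Computational_Algebra.Polynomial"
begin

section \<open>Continuous one-counter pushdown VASS\<close>

datatype 'g stack_op = Push 'g | Pop 'g | NoOp

record ('s, 'g) c1pvass =
  states :: "'s set"
  stack_alphabet :: "'g set"
  trans :: "'s \<Rightarrow> 's \<Rightarrow> (int \<times> 'g stack_op) option"
  bottom :: 'g
  init :: 's
  final :: 's
  guard :: "'s \<Rightarrow> nat"

definition wf_c1pvass :: "('s, 'g) c1pvass \<Rightarrow> bool" where
  "wf_c1pvass A \<longleftrightarrow>
     finite (states A) \<and> finite (stack_alphabet A) \<and>
     bottom A \<in> stack_alphabet A \<and> init A \<in> states A \<and> final A \<in> states A \<and>
     (\<forall>s t z oper. trans A s t = Some (z, oper) \<longrightarrow>
        s \<in> states A \<and> t \<in> states A \<and> set_stack_op oper \<subseteq> stack_alphabet A - {bottom A})"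

definition zero_c1pvass :: "('s, 'g) c1pvass \<Rightarrow> bool" where
  "zero_c1pvass A \<longleftrightarrow> wf_c1pvass A \<and> (\<forall>s \<in> states A. guard A s = 0)"

text \<open>Stacks are words whose top symbol is the last one.\<close>

type_synonym ('s, 'g) config = "'s \<times> 'g list \<times> real"

definition is_config :: "('s, 'g) c1pvass \<Rightarrow> ('s, 'g) config \<Rightarrow> bool" where
  "is_config A = (\<lambda>(s, \<alpha>, c).
     s \<in> states A \<and> set \<alpha> \<subseteq> stack_alphabet A \<and> 0 \<le> c \<and> real (guard A s) \<le> c)"

definition init_config :: "('s, 'g) c1pvass \<Rightarrow> ('s, 'g) config" where
  "init_config A = (init A, [bottom A], 0)"

fun stack_step :: "'g stack_op \<Rightarrow> 'g list \<Rightarrow> 'g list \<Rightarrow> bool" where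
  "stack_step NoOp \<alpha> \<beta> \<longleftrightarrow> \<beta> = \<alpha>"
| "stack_step (Push a) \<alpha> \<beta> \<longleftrightarrow> \<beta> = \<alpha> @ [a]"
| "stack_step (Pop a) \<alpha> \<beta> \<longleftrightarrow> \<alpha> = \<beta> @ [a]"

definition config_step :: "('s, 'g) c1pvass \<Rightarrow> ('s, 'g) config \<Rightarrow> ('s, 'g) config \<Rightarrow> bool" where
  "config_step A = (\<lambda>(s, \<alpha>, c) (s', \<alpha>', c').
     \<exists>z oper. trans A s s' = Some (z, oper) \<and> stack_step oper \<alpha> \<alpha>' \<and>
       (\<exists>\<gamma>::real. 0 < \<gamma> \<and> \<gamma> \<le> 1 \<and> c' = c + \<gamma> * real_of_int z))"

definition is_run :: "('s, 'g) c1pvass \<Rightarrow> ('s, 'g) config list \<Rightarrow> bool" where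
  "is_run A \<rho> \<longleftrightarrow>
     \<rho> \<noteq> [] \<and> hd \<rho> = init_config A \<and> (\<forall>q \<in> set \<rho>. is_config A q) \<and>
     (\<forall>i. Suc i < length \<rho> \<longrightarrow> config_step A (\<rho> ! i) (\<rho> ! Suc i))"

definition reaching :: "('s, 'g) c1pvass \<Rightarrow> real \<Rightarrow> ('s, 'g) config list \<Rightarrow> bool" where
  "reaching A k \<rho> \<longleftrightarrow> is_run A \<rho> \<and> (case last \<rho> of (s, \<alpha>, c) \<Rightarrow> s = final A \<and> c = k)"

definition covering :: "('s, 'g) c1pvass \<Rightarrow> real \<Rightarrow> ('s, 'g) config list \<Rightarrow> bool" where
  "covering A k \<rho> \<longleftrightarrow> is_run A \<rho> \<and> (case last \<rho> of (s, \<alpha>, c) \<Rightarrow> s = final A \<and> k \<le> c)"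


section \<open>Polynomial-time decidability by deterministic multi-tape Turing machines\<close>

text \<open>
  Tape symbols over an input alphabet \<open>'i\<close>: the blank, the input symbols, and a supply of
  auxiliary symbols, of which each machine uses only finitely many.
\<close>

datatype 'i symbol = Blank | Inp 'i | Aux nat

datatype direction = Left | Stay | Right

record 'i tm =
  tm_tapes :: nat
  tm_states :: "nat set"
  tm_symbols :: "'i symbol set"
  tm_start :: nat
  tm_accept :: nat
  tm_reject :: nat
  tm_trans :: "nat \<Rightarrow> 'i symbol list \<Rightarrow> nat \<times> ('i symbol \<times> direction) list"

text \<open>The transition function only matters, and is only constrained, on the finite set of pairs
  of a state and a tuple of scanned symbols.\<close>

definition wf_tm :: "'i tm \<Rightarrow> bool" where
  "wf_tm M \<longleftrightarrow>
     1 \<le> tm_tapes M \<and> finite (tm_states M) \<and> finite (tm_symbols M) \<and>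
     Blank \<in> tm_symbols M \<and> range Inp \<subseteq> tm_symbols M \<and>
     tm_start M \<in> tm_states M \<and> tm_accept M \<in> tm_states M \<and> tm_reject M \<in> tm_states M \<and>
     tm_accept M \<noteq> tm_reject M \<and>
     (\<forall>q \<in> tm_states M. \<forall>as. length as = tm_tapes M \<and> set as \<subseteq> tm_symbols M \<longrightarrow>
        (case tm_trans M q as of (q', acts) \<Rightarrow>
           q' \<in> tm_states M \<and> length acts = tm_tapes M \<and> fst ` set acts \<subseteq> tm_symbols M))"

text \<open>Tapes are infinite in both directions; a tape is paired with its head position.\<close>

type_synonym 'i tape = "(int \<Rightarrow> 'i symbol) \<times> int"
type_synonym 'i tm_config = "nat \<times> 'i tape list"

fun move :: "direction \<Rightarrow> int \<Rightarrow> int" where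
  "move Left h = h - 1"
| "move Stay h = h"
| "move Right h = h + 1"

definition tape_read :: "'i tape \<Rightarrow> 'i symbol" where
  "tape_read = (\<lambda>(t, h). t h)"

definition tape_act :: "'i symbol \<times> direction \<Rightarrow> 'i tape \<Rightarrow> 'i tape" where
  "tape_act = (\<lambda>(a, d) (t, h). (t(h := a), move d h))"

definition tm_step :: "'i tm \<Rightarrow> 'i tm_config \<Rightarrow> 'i tm_config" where
  "tm_step M = (\<lambda>(q, ts).
     if q = tm_accept M \<or> q = tm_reject M then (q, ts)
     else (case tm_trans M q (map tape_read ts) of (q', acts) \<Rightarrow> (q', map2 tape_act acts ts)))"

definition input_tape :: "'i list \<Rightarrow> 'i tape" where
  "input_tape w = ((\<lambda>i. if 0 \<le> i \<and> i < int (length w) then Inp (w ! nat i) else Blank), 0)"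

definition empty_tape :: "'i tape" where
  "empty_tape = ((\<lambda>_. Blank), 0)"

definition tm_init :: "'i tm \<Rightarrow> 'i list \<Rightarrow> 'i tm_config" where
  "tm_init M w = (tm_start M, input_tape w # replicate (tm_tapes M - 1) empty_tape)"

definition tm_state_after :: "'i tm \<Rightarrow> 'i list \<Rightarrow> nat \<Rightarrow> nat" where
  "tm_state_after M w n = fst ((tm_step M ^^ n) (tm_init M w))"

text \<open>
  A decision problem is given by a set \<open>I\<close> of instances, an encoding of instances as words, and
  the property \<open>P\<close> to be decided. Halting configurations are fixed points of \<^const>\<open>tm_step\<close>, so
  the state after \<open>p(n)\<close> steps tells whether the machine has accepted or rejected by then.
\<close>

definition poly_time_decidable :: "'x set \<Rightarrow> ('x \<Rightarrow> 'i list) \<Rightarrow> ('x \<Rightarrow> bool) \<Rightarrow> bool" where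
  "poly_time_decidable I enc P \<longleftrightarrow>
     (\<exists>(M :: 'i tm) (p :: nat poly). wf_tm M \<and>
        (\<forall>x \<in> I. tm_state_after M (enc x) (poly p (length (enc x))) =
                   (if P x then tm_accept M else tm_reject M)))"


section \<open>Encoding of C1PVASS as words\<close>

text \<open>
  States and stack symbols are named by natural numbers; up to renaming this covers all C1PVASS.
  All numbers (names, guards, counter updates) are written in binary, most significant bit first.
  Every state and every stack symbol is listed, so the length of the word bounds their number.
\<close>

datatype token = Bit bool | Minus | PushMark | PopMark | Comma | Semicolon | Hash

fun enc_nat :: "nat \<Rightarrow> token list" where
  "enc_nat n = (if n < 2 then [Bit (n = 1)] else enc_nat (n div 2) @ [Bit (odd n)])"

declare enc_nat.simps [simp del]

definition enc_int :: "int \<Rightarrow> token list" where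
  "enc_int z = (if z < 0 then [Minus] else []) @ enc_nat (nat \<bar>z\<bar>)"

fun enc_op :: "nat stack_op \<Rightarrow> token list" where
  "enc_op NoOp = []"
| "enc_op (Push a) = PushMark # enc_nat a"
| "enc_op (Pop a) = PopMark # enc_nat a"

definition enc_state :: "(nat, nat) c1pvass \<Rightarrow> nat \<Rightarrow> token list" where
  "enc_state A s = enc_nat s @ [Comma] @ enc_nat (guard A s) @ [Semicolon]"

definition enc_trans :: "(nat, nat) c1pvass \<Rightarrow> nat \<Rightarrow> nat \<Rightarrow> token list" where
  "enc_trans A s t = (case trans A s t of
       None \<Rightarrow> []
     | Some (z, oper) \<Rightarrow>
         enc_nat s @ [Comma] @ enc_nat t @ [Comma] @ enc_int z @ [Comma] @ enc_op oper @ [Semicolon])"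

definition encode :: "(nat, nat) c1pvass \<Rightarrow> token list" where
  "encode A =
     (let S = sorted_list_of_set (states A); \<Gamma> = sorted_list_of_set (stack_alphabet A) in
        enc_nat (init A) @ [Hash] @ enc_nat (final A) @ [Hash] @ enc_nat (bottom A) @ [Hash] @
        concat (map (enc_state A) S) @ [Hash] @
        concat (map (\<lambda>a. enc_nat a @ [Semicolon]) \<Gamma>) @ [Hash] @
        concat (map (\<lambda>s. concat (map (enc_trans A s) S)) S))"

end

theory Submission
  imports Defs
begin

text \<open>
  Only the signs of the updates along a run matter: the scaling factors can be chosen so that the
  counter stays strictly between 0 and 1 once it is positive, and then any decrement can also reach
  0 exactly. So a run to a state exists iff there is a path there, respecting the stack, whose first
  nonzero update, if any, is positive; it can end with counter 0 iff in addition the last nonzero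
  update, if any, is negative.

  Such paths are found by saturation: a fact \<open>(p, q, x, a, b)\<close> summarises paths from \<open>p\<close> to \<open>q\<close> with
  stack effect \<open>x\<close> (none, one push, one pop, or some unmatched pushes) whose first and last nonzero
  signs are \<open>a\<close> and \<open>b\<close>. Facts are composed by a single binary rule, and there are only polynomially
  many of them.

  That saturation runs in polynomial time on a Turing machine follows from closure properties of the
  functions computable in polynomial time on tree-encoded data. These are implemented by structured
  programs that use the tapes as stacks; a program becomes a machine whose states are the
  continuations of the program.
\<close>

section \<open>Structured programs on Turing machine tapes\<close>

text \<open>Unbounded stacks are the obstacle: a summary that recorded every unmatched push would
  range over infinitely many words. But a pushed symbol is either popped later, and then one push
  fact meets the matching pop fact, or it stays for good, and then its name no longer matters. So
  two or more unmatched pushes collapse to one anonymous effect. Facts then lie in a product of five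
  sets, each of size linear in the number of transitions; this is the origin of the exponent 5, and
  saturation simply runs for that many rounds.

  On the machine side, the time of a composition depends on the size of the intermediate result, and
  iteration can blow data up exponentially.\<close>

datatype 'i prog =
    Act "'i symbol list \<Rightarrow> ('i symbol \<times> direction) list"
  | Seq "'i prog" "'i prog"
  | Cond "'i symbol list \<Rightarrow> bool" "'i prog" "'i prog"
  | Loop "'i symbol list \<Rightarrow> bool" "'i prog"

definition idle :: "'i symbol list \<Rightarrow> ('i symbol \<times> direction) list" where
  "idle as = map (\<lambda>a. (a, Stay)) as"

definition act_all :: "('i symbol \<times> direction) list \<Rightarrow> 'i tape list \<Rightarrow> 'i tape list" where
  "act_all acts ts = map2 tape_act acts ts"

text \<open>The step count is exact. Unfolding a control construct costs one step because the
  machine spends one transition on replacing the head of its continuation.\<close>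

inductive exec :: "'i prog \<Rightarrow> 'i tape list \<Rightarrow> nat \<Rightarrow> 'i tape list \<Rightarrow> bool" where
  exec_Act: "exec (Act f) ts 1 (act_all (f (map tape_read ts)) ts)"
| exec_Seq: "exec c ts m ts' \<Longrightarrow> exec d ts' n ts'' \<Longrightarrow> exec (Seq c d) ts (1 + m + n) ts''"
| exec_Cond: "exec (if b (map tape_read ts) then c else d) ts n ts' \<Longrightarrow>
    exec (Cond b c d) ts (1 + n) ts'"
| exec_Loop_stop: "\<not> b (map tape_read ts) \<Longrightarrow> exec (Loop b c) ts 1 ts"
| exec_Loop_step: "b (map tape_read ts) \<Longrightarrow> exec c ts m ts' \<Longrightarrow> exec (Loop b c) ts' n ts'' \<Longrightarrow>
    exec (Loop b c) ts (1 + m + n) ts''"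

fun next_cont :: "'i prog list \<Rightarrow> 'i symbol list \<Rightarrow> 'i prog list \<times> ('i symbol \<times> direction) list" where
  "next_cont [] as = ([], idle as)"
| "next_cont (Act f # K) as = (K, f as)"
| "next_cont (Seq c d # K) as = (c # d # K, idle as)"
| "next_cont (Cond b c d # K) as = ((if b as then c else d) # K, idle as)"
| "next_cont (Loop b c # K) as = (if b as then c # Loop b c # K else K, idle as)"

text \<open>An over-approximation of the continuations met while \<open>c\<close> runs before
  \<open>K\<close>, with \<open>K\<close> itself left out. It stays finite in the presence of loops
  because the body is always followed by the same continuation \<open>Loop b c # K\<close>.\<close>

fun conts :: "'i prog \<Rightarrow> 'i prog list \<Rightarrow> 'i prog list set" where
  "conts (Act f) K = {Act f # K}"
| "conts (Seq c d) K = insert (Seq c d # K) (conts c (d # K) \<union> conts d K)"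
| "conts (Cond b c d) K = insert (Cond b c d # K) (conts c K \<union> conts d K)"
| "conts (Loop b c) K = insert (Loop b c # K) (conts c (Loop b c # K))"

fun prog_wf :: "nat \<Rightarrow> 'i symbol set \<Rightarrow> 'i prog \<Rightarrow> bool" where
  "prog_wf k \<Sigma> (Act f) \<longleftrightarrow> (\<forall>as. length as = k \<and> set as \<subseteq> \<Sigma> \<longrightarrow>
     length (f as) = k \<and> fst ` set (f as) \<subseteq> \<Sigma>)"
| "prog_wf k \<Sigma> (Seq c d) \<longleftrightarrow> prog_wf k \<Sigma> c \<and> prog_wf k \<Sigma> d"
| "prog_wf k \<Sigma> (Cond b c d) \<longleftrightarrow> prog_wf k \<Sigma> c \<and> prog_wf k \<Sigma> d"
| "prog_wf k \<Sigma> (Loop b c) \<longleftrightarrow> prog_wf k \<Sigma> c"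

lemma act_all_idle: "act_all (idle (map tape_read ts)) ts = ts"
  by (induction ts) (auto simp: act_all_def idle_def tape_act_def tape_read_def)

lemma finite_conts: "finite (conts c K)"
  by (induction c arbitrary: K) auto

lemma conts_self: "c # K \<in> conts c K"
  by (cases c) auto

lemma conts_closed: "L \<in> conts c K \<Longrightarrow> fst (next_cont L as) \<in> insert K (conts c K)"
proof (induction c arbitrary: K L)
  case (Seq c d)
  show ?case
  proof (cases "L = Seq c d # K")
    case True then show ?thesis using conts_self[of c "d # K"] by auto
  next
    case False
    then consider "L \<in> conts c (d # K)" | "L \<in> conts d K" using Seq.prems by auto
    then show ?thesis
      using Seq.IH(1)[of L "d # K"] Seq.IH(2)[of L K] conts_self[of d K] by cases auto
  qed
next
  case (Cond b c d)
  show ?case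
  proof (cases "L = Cond b c d # K")
    case True then show ?thesis using conts_self[of c K] conts_self[of d K] by auto
  next
    case False
    then consider "L \<in> conts c K" | "L \<in> conts d K" using Cond.prems by auto
    then show ?thesis using Cond.IH(1)[of L K] Cond.IH(2)[of L K] by cases auto
  qed
next
  case (Loop b c)
  show ?case
  proof (cases "L = Loop b c # K")
    case True then show ?thesis using conts_self[of c "Loop b c # K"] by auto
  next
    case False
    then have "L \<in> conts c (Loop b c # K)" using Loop.prems by auto
    then show ?thesis using Loop.IH[of L "Loop b c # K"] by auto
  qed
qed auto

lemma next_cont_wf:
  assumes "L \<in> conts c K" "prog_wf k \<Sigma> c" "length as = k" "set as \<subseteq> \<Sigma>"
  shows "L \<noteq> [] \<and> length (snd (next_cont L as)) = k \<and> fst ` set (snd (next_cont L as)) \<subseteq> \<Sigma>"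
  using assms
proof (induction c arbitrary: K)
  case (Seq c d)
  then show ?case by (auto simp: idle_def image_image)
next
  case (Cond b c d)
  then show ?case by (auto simp: idle_def image_image)
next
  case (Loop b c)
  then show ?case by (auto simp: idle_def image_image)
qed auto

text \<open>The finitely many continuations are numbered below \<open>m\<close>, and
  \<open>m\<close> and \<open>m + 1\<close> become the halting states. The empty continuation takes
  one further step to evaluate \<open>t\<close> on the scanned symbols, hence the strict
  \<open>n < N\<close>; a halted machine stays as it is, hence every such \<open>N\<close>
  works.\<close>

theorem prog_tm:
  fixes c :: "'i prog"
  assumes wf: "prog_wf k \<Sigma> c" and k: "1 \<le> k"
    and \<Sigma>: "finite \<Sigma>" "Blank \<in> \<Sigma>" "range Inp \<subseteq> \<Sigma>"
  shows "\<exists>M :: 'i tm. wf_tm M \<and>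
    (\<forall>w n ts N. exec c (input_tape w # replicate (k - 1) empty_tape) n ts \<and> n < N \<longrightarrow>
      tm_state_after M w N = (if t (map tape_read ts) then tm_accept M else tm_reject M))"
proof -
  define S where "S = insert [] (conts c [])"
  have finS: "finite S" by (simp add: S_def finite_conts)
  obtain h :: "'i prog list \<Rightarrow> nat" and m where hS: "h ` S = {i. i < m}" and inj: "inj_on h S"
    using finite_imp_inj_to_nat_seg[OF finS] by metis
  define g where "g = the_inv_into S h"
  have gh: "g (h K) = K" if "K \<in> S" for K
    using that inj by (simp add: g_def the_inv_into_f_f)
  have gS: "g q \<in> S" if "q < m" for q
    using that hS inj by (metis g_def mem_Collect_eq order_refl the_inv_into_into)
  have hlt: "h K < m" if "K \<in> S" for K
    using that hS by auto
  have closed: "fst (next_cont K as) \<in> S" if "K \<in> S" "K \<noteq> []" for K as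
    using that conts_closed[of K c "[]" as] by (auto simp: S_def)
  define tr where "tr = (\<lambda>q as. if q < m then
      (if g q = [] then (if t as then m else m + 1, idle as)
       else (h (fst (next_cont (g q) as)), snd (next_cont (g q) as))) else (q, idle as))"
  define M where "M = \<lparr>tm_tapes = k, tm_states = {..<m + 2}, tm_symbols = \<Sigma>,
     tm_start = h [c], tm_accept = m, tm_reject = m + 1, tm_trans = tr\<rparr>"
  have cS: "[c] \<in> S" by (simp add: S_def conts_self)
  have idle: "length (idle as) = length as \<and> fst ` set (idle as) = set as" for as :: "'i symbol list"
    by (auto simp: idle_def image_image)
  have "wf_tm M"
    unfolding wf_tm_def
  proof (intro conjI ballI allI impI)
    fix q as assume q: "q \<in> tm_states M" and as: "length as = tm_tapes M \<and> set as \<subseteq> tm_symbols M"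
    have as': "length as = k" "set as \<subseteq> \<Sigma>" using as by (auto simp: M_def)
    show "case tm_trans M q as of (q', acts) \<Rightarrow>
      q' \<in> tm_states M \<and> length acts = tm_tapes M \<and> fst ` set acts \<subseteq> tm_symbols M"
    proof (cases "q < m \<and> g q \<noteq> []")
      case True
      then have "g q \<in> conts c []" using gS[of q] by (auto simp: S_def)
      from next_cont_wf[OF this wf as'] closed[of "g q" as] hlt gS[of q] True show ?thesis
        by (auto simp: M_def tr_def less_SucI)
    next
      case False
      then show ?thesis using q as' idle[of as] by (auto simp: M_def tr_def)
    qed
  qed (use k \<Sigma> hlt[OF cS] in \<open>auto simp: M_def\<close>)
  moreover
  have step: "tm_step M (h K, ts) =
      (h (fst (next_cont K (map tape_read ts))), act_all (snd (next_cont K (map tape_read ts))) ts)"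
    if "K \<in> S" "K \<noteq> []" for K ts
    using that hlt[of K] by (simp add: tm_step_def M_def tr_def gh act_all_def)
  \<comment> \<open>\<open>K\<close> must be arbitrary: the first half of a sequence runs with the
    second half put in front of \<open>K\<close>.\<close>
  have run: "(tm_step M ^^ n) (h (d # K), ts) = (h K, ts') \<and> K \<in> S"
    if "exec d ts n ts'" "d # K \<in> S" for d K ts ts' n
    using that
  proof (induction d ts n ts' arbitrary: K rule: exec.induct)
    case (exec_Act f ts)
    then show ?case using closed[of "Act f # K"] by (auto simp: step)
  next
    case (exec_Seq d ts m ts' e n ts'')
    have "d # e # K \<in> S" using closed[OF exec_Seq.prems] by auto
    from exec_Seq.IH(1)[OF this] exec_Seq.IH(2) show ?case
      using exec_Seq.prems by (simp add: step act_all_idle funpow_add funpow_swap1 add.commute[of m n])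
  next
    case (exec_Cond b ts d e n ts')
    have "(if b (map tape_read ts) then d else e) # K \<in> S"
      using closed[OF exec_Cond.prems, of "map tape_read ts"] by auto
    from exec_Cond.IH[OF this] show ?case
      using exec_Cond.prems by (simp add: step act_all_idle funpow_swap1)
  next
    case (exec_Loop_stop b ts d)
    then show ?case using closed[of "Loop b d # K" "map tape_read ts"]
      by (auto simp: step act_all_idle)
  next
    case (exec_Loop_step b ts d m ts' n ts'')
    have "d # Loop b d # K \<in> S"
      using closed[OF exec_Loop_step.prems, of "map tape_read ts"] exec_Loop_step.hyps by auto
    from exec_Loop_step.IH(1)[OF this] exec_Loop_step.IH(2) show ?case
      using exec_Loop_step.prems exec_Loop_step.hyps
      by (simp add: step act_all_idle funpow_add funpow_swap1 add.commute[of m n])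
  qed
  have halt: "(tm_step M ^^ i) (q, ts) = (q, ts)" if "q = m \<or> q = m + 1" for q ts i
    using that by (induction i) (auto simp: tm_step_def M_def)
  have "tm_state_after M w N = (if t (map tape_read ts) then tm_accept M else tm_reject M)"
    if ex: "exec c (input_tape w # replicate (k - 1) empty_tape) n ts" and "n < N" for w n ts N
  proof -
    obtain i where N: "N = i + Suc n" using \<open>n < N\<close> less_iff_Suc_add[of n N] by auto
    have 1: "(tm_step M ^^ n) (tm_init M w) = (h [], ts)"
      using run[OF ex cS] by (simp add: tm_init_def M_def)
    have 2: "tm_step M (h [], ts) = (if t (map tape_read ts) then m else m + 1, ts)"
      using hlt[of "[]"] by (simp add: tm_step_def M_def tr_def gh S_def act_all_idle[unfolded act_all_def])
    show ?thesis
      unfolding tm_state_after_def N funpow_add funpow.simps o_apply 1 2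
      using halt by (simp add: M_def)
  qed
  ultimately show ?thesis by blast
qed

section \<open>Tapes as stacks\<close>

type_synonym sym = "token symbol"

text \<open>\<open>Aux 0\<close> will mark inner nodes of trees, \<open>Aux 1\<close> empty trees
  and the units of a unary counter; the input tokens serve as leaves.\<close>

definition syms :: "sym set" where
  "syms = insert Blank (insert (Aux 0) (insert (Aux 1) (range Inp)))"

lemma UNIV_token: "(UNIV :: token set) =
  {Bit True, Bit False, Minus, PushMark, PopMark, Comma, Semicolon, Hash}"
proof -
  have "x \<in> {Bit True, Bit False, Minus, PushMark, PopMark, Comma, Semicolon, Hash}" for x
    by (cases x) auto
  then show ?thesis by blast
qed

lemma finite_syms: "finite syms"
  by (simp add: syms_def UNIV_token)

definition stack_top :: "sym list \<Rightarrow> sym" where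
  "stack_top xs = (case xs of [] \<Rightarrow> Blank | x # _ \<Rightarrow> x)"

lemma stack_top_simps [simp]: "stack_top [] = Blank" "stack_top (x # xs) = x"
  by (auto simp: stack_top_def)

lemma stack_top_Blank: "Blank \<notin> set xs \<Longrightarrow> stack_top xs = Blank \<longleftrightarrow> xs = []"
  by (cases xs) auto

text \<open>The head is at the top of the stack; \<open>d\<close> is the direction in which the stack grows. The
  input tape is a stack growing to the left, the other tapes are stacks growing to the right.\<close>

definition stack_tape :: "int \<Rightarrow> sym list \<Rightarrow> token tape \<Rightarrow> bool" where
  "stack_tape d xs = (\<lambda>(t, h). Blank \<notin> set xs \<and>
     (\<forall>j::nat. t (h - d * int j) = (if j < length xs then xs ! j else Blank)) \<and>
     (\<forall>j::nat. t (h + d * int (Suc j)) = Blank))"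

abbreviation growth :: "nat \<Rightarrow> int" where
  "growth i \<equiv> if i = 0 then - 1 else 1"

text \<open>Tape 0 holds the input, tape 1 is the main stack with all data, tapes 2 and 3 are
  scratch space, and tape 4 is a unary counter.\<close>

definition stacks :: "sym list list \<Rightarrow> token tape list \<Rightarrow> bool" where
  "stacks \<sigma> ts \<longleftrightarrow> length \<sigma> = 5 \<and> length ts = 5 \<and> (\<forall>i<5. stack_tape (growth i) (\<sigma> ! i) (ts ! i))"

text \<open>A stack does not determine its tape, since the head may stand anywhere; hence the
  quantification over all representing tapes. Unlike in \<open>exec\<close> the time is an upper
  bound, so that estimates can be weakened.\<close>

definition runs :: "token prog \<Rightarrow> sym list list \<Rightarrow> nat \<Rightarrow> sym list list \<Rightarrow> bool" where
  "runs c \<sigma> n \<sigma>' \<longleftrightarrow> (\<forall>ts. stacks \<sigma> ts \<longrightarrow> (\<exists>m ts'. m \<le> n \<and> exec c ts m ts' \<and> stacks \<sigma>' ts'))"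

lemma tape_read_stack: "stack_tape d xs T \<Longrightarrow> tape_read T = stack_top xs"
  by (cases T; cases xs) (auto simp: stack_tape_def tape_read_def dest: spec[of _ 0])

lemma stacks_reads: "stacks \<sigma> ts \<Longrightarrow> map tape_read ts = map stack_top \<sigma>"
  by (rule nth_equalityI) (auto simp: stacks_def intro: tape_read_stack)

lemma stacks_no_Blank: "stacks \<sigma> ts \<Longrightarrow> i < 5 \<Longrightarrow> Blank \<notin> set (\<sigma> ! i)"
  by (auto simp: stacks_def stack_tape_def split: prod.splits)

text \<open>When no tapes represent \<open>\<sigma>\<close>, \<open>runs\<close> holds vacuously, so
  the properties of representable stacks may be assumed.\<close>

lemma runs_no_Blank: "(length \<sigma> = 5 \<Longrightarrow> (\<And>i. i < 5 \<Longrightarrow> Blank \<notin> set (\<sigma> ! i)) \<Longrightarrow> runs c \<sigma> n \<sigma>') \<Longrightarrow> runs c \<sigma> n \<sigma>'"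
  unfolding runs_def using stacks_no_Blank stacks_def by blast

lemma runs_mono: "runs c \<sigma> m \<sigma>' \<Longrightarrow> m \<le> n \<Longrightarrow> runs c \<sigma> n \<sigma>'"
  unfolding runs_def by (blast intro: le_trans)

lemma runsE:
  assumes "runs c \<sigma> n \<sigma>'" "stacks \<sigma> ts"
  obtains m ts' where "m \<le> n" "exec c ts m ts'" "stacks \<sigma>' ts'"
  using assms by (auto simp: runs_def)

lemma runsI:
  assumes "\<And>ts. stacks \<sigma> ts \<Longrightarrow> map tape_read ts = map stack_top \<sigma> \<Longrightarrow>
    \<exists>m ts'. m \<le> n \<and> exec c ts m ts' \<and> stacks \<sigma>' ts'"
  shows "runs c \<sigma> n \<sigma>'"
  using assms stacks_reads by (simp add: runs_def)

lemma runs_Seq: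
  assumes "runs c \<sigma> m \<sigma>'" "runs d \<sigma>' n \<sigma>''"
  shows "runs (Seq c d) \<sigma> (1 + m + n) \<sigma>''"
proof (rule runsI)
  fix ts assume "stacks \<sigma> ts"
  from runsE[OF assms(1) this] obtain m' ts' where 1: "m' \<le> m" "exec c ts m' ts'" "stacks \<sigma>' ts'" .
  from runsE[OF assms(2) 1(3)] obtain n' ts'' where 2: "n' \<le> n" "exec d ts' n' ts''" "stacks \<sigma>'' ts''" .
  show "\<exists>k ts'. k \<le> 1 + m + n \<and> exec (Seq c d) ts k ts' \<and> stacks \<sigma>'' ts'"
    using exec_Seq[OF 1(2) 2(2)] 1(1) 2(1,3) by (intro exI[of _ "1 + m' + n'"] exI[of _ ts'']) simp
qed

lemma runs_Cond:
  assumes "runs (if b (map stack_top \<sigma>) then c else d) \<sigma> n \<sigma>'"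
  shows "runs (Cond b c d) \<sigma> (1 + n) \<sigma>'"
proof (rule runsI)
  fix ts assume ts: "stacks \<sigma> ts" "map tape_read ts = map stack_top \<sigma>"
  from runsE[OF assms ts(1)] obtain n' ts' where
    1: "n' \<le> n" "exec (if b (map stack_top \<sigma>) then c else d) ts n' ts'" "stacks \<sigma>' ts'" .
  show "\<exists>k ts'. k \<le> 1 + n \<and> exec (Cond b c d) ts k ts' \<and> stacks \<sigma>' ts'"
    using exec_Cond[of b ts c d n' ts'] 1 ts(2) by (intro exI[of _ "1 + n'"] exI[of _ ts']) simp
qed

lemma runs_Loop_stop:
  assumes "\<not> b (map stack_top \<sigma>)"
  shows "runs (Loop b c) \<sigma> 1 \<sigma>"
proof (rule runsI)
  fix ts assume "stacks \<sigma> ts" "map tape_read ts = map stack_top \<sigma>"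
  then show "\<exists>k ts'. k \<le> 1 \<and> exec (Loop b c) ts k ts' \<and> stacks \<sigma> ts'"
    using assms exec_Loop_stop[of b ts c] by (intro exI[of _ 1] exI[of _ ts]) simp
qed

lemma runs_Loop_step:
  assumes "b (map stack_top \<sigma>)" "runs c \<sigma> m \<sigma>'" "runs (Loop b c) \<sigma>' n \<sigma>''"
  shows "runs (Loop b c) \<sigma> (1 + m + n) \<sigma>''"
proof (rule runsI)
  fix ts assume ts: "stacks \<sigma> ts" "map tape_read ts = map stack_top \<sigma>"
  from runsE[OF assms(2) ts(1)] obtain m' ts' where 1: "m' \<le> m" "exec c ts m' ts'" "stacks \<sigma>' ts'" .
  from runsE[OF assms(3) 1(3)] obtain n' ts''
    where 2: "n' \<le> n" "exec (Loop b c) ts' n' ts''" "stacks \<sigma>'' ts''" .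
  show "\<exists>k ts'. k \<le> 1 + m + n \<and> exec (Loop b c) ts k ts' \<and> stacks \<sigma>'' ts'"
    using exec_Loop_step[OF _ 1(2) 2(2)] 1(1) 2(1,3) ts(2) assms(1)
    by (intro exI[of _ "1 + m' + n'"] exI[of _ ts'']) simp
qed

section \<open>Operations on the top of a stack\<close>

definition act_at :: "nat \<Rightarrow> (sym list \<Rightarrow> sym) \<Rightarrow> direction \<Rightarrow> token prog" where
  "act_at i s d = Act (\<lambda>as. (idle as)[i := (s as, d)])"

lemma act_at_wf:
  assumes "i < 5" "\<And>as. length as = 5 \<Longrightarrow> set as \<subseteq> syms \<Longrightarrow> s as \<in> syms"
  shows "prog_wf 5 syms (act_at i s d)"
proof -
  have "fst ` set ((idle as)[i := (s as, d)]) \<subseteq> syms" if "length as = 5" "set as \<subseteq> syms" for as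
  proof -
    have "set ((idle as)[i := (s as, d)]) \<subseteq> insert (s as, d) (set (idle as))"
      by (rule set_update_subset_insert)
    then have "fst ` set ((idle as)[i := (s as, d)]) \<subseteq> fst ` insert (s as, d) (set (idle as))"
      by (rule image_mono)
    with that assms(2)[OF that] show ?thesis by (auto simp: idle_def image_image)
  qed
  then show ?thesis by (simp add: act_at_def idle_def)
qed

lemma exec_act_at:
  assumes "i < length ts"
  shows "exec (act_at i s d) ts 1 (ts[i := tape_act (s (map tape_read ts), d) (ts ! i)])"
proof -
  have "act_all ((idle (map tape_read ts))[i := (s (map tape_read ts), d)]) ts =
      ts[i := tape_act (s (map tape_read ts), d) (ts ! i)]"
  proof (rule nth_equalityI)
    fix j assume "j < length (act_all ((idle (map tape_read ts))[i := (s (map tape_read ts), d)]) ts)"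
    then have j: "j < length ts" by (simp add: act_all_def idle_def)
    have "tape_act (tape_read T, Stay) T = T" for T :: "token tape"
      by (auto simp: tape_act_def tape_read_def split: prod.splits)
    then show "act_all ((idle (map tape_read ts))[i := (s (map tape_read ts), d)]) ts ! j =
      ts[i := tape_act (s (map tape_read ts), d) (ts ! i)] ! j"
      using j assms by (cases "i = j") (auto simp: act_all_def idle_def)
  qed (simp add: act_all_def idle_def)
  then show ?thesis using exec_Act[of "\<lambda>as. (idle as)[i := (s as, d)]" ts] by (simp add: act_at_def)
qed

lemma stacks_update:
  "stacks \<sigma> ts \<Longrightarrow> stack_tape (growth i) xs T \<Longrightarrow> stacks (\<sigma>[i := xs]) (ts[i := T])"
  by (cases "i < 5") (auto simp: stacks_def nth_list_update)

text \<open>Blanking the cell before leaving it keeps everything above the top blank. On an empty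
  stack the head merely moves over blanks, in agreement with \<open>tl [] = []\<close>.\<close>

definition pop :: "nat \<Rightarrow> token prog" where
  "pop i = act_at i (\<lambda>_. Blank) (if i = 0 then Right else Left)"

text \<open>The head must step onto the free cell before writing, so \<open>s\<close> is evaluated
  when tape \<open>j\<close> already scans a blank; the other tapes still show their tops.\<close>

definition push :: "nat \<Rightarrow> (sym list \<Rightarrow> sym) \<Rightarrow> token prog" where
  "push j s = Seq (act_at j (\<lambda>as. as ! j) Right) (act_at j s Stay)"

lemma runs_pop:
  assumes "i < 5"
  shows "runs (pop i) \<sigma> 1 (\<sigma>[i := tl (\<sigma> ! i)])"
  unfolding runs_def
proof (intro allI impI)
  fix ts assume s: "stacks \<sigma> ts"
  obtain t h where T: "ts ! i = (t, h)" by fastforce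
  define d where "d = growth i"
  have st: "stack_tape d (\<sigma> ! i) (t, h)" using s assms T by (auto simp: stacks_def d_def)
  have d: "d = 1 \<or> d = - 1" by (auto simp: d_def)
  have "stack_tape d (tl (\<sigma> ! i)) (t(h := Blank), h - d)"
  proof -
    have 1: "(t(h := Blank)) (h - d - d * int j) = (if j < length (tl (\<sigma> ! i)) then tl (\<sigma> ! i) ! j else Blank)" for j
    proof -
      have "t (h - d * int (Suc j)) = (if Suc j < length (\<sigma> ! i) then \<sigma> ! i ! Suc j else Blank)"
        using st unfolding stack_tape_def by blast
      moreover have "h - d - d * int j \<noteq> h" using d by auto
      ultimately show ?thesis by (auto simp: nth_tl algebra_simps)
    qed
    have 2: "(t(h := Blank)) (h - d + d * int (Suc j)) = Blank" for j
    proof (cases j)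
      case (Suc j')
      have "t (h + d * int (Suc j')) = Blank" using st unfolding stack_tape_def by blast
      then show ?thesis using Suc by (auto simp: algebra_simps)
    qed simp
    have "Blank \<notin> set (tl (\<sigma> ! i))" using st by (auto simp: stack_tape_def dest: list.set_sel(2))
       (metis list.sel(2) list.set_sel(2))
    with 1 2 show ?thesis by (auto simp: stack_tape_def)
  qed
  moreover have "tape_act (Blank, if i = 0 then Right else Left) (ts ! i) = (t(h := Blank), h - d)"
    by (auto simp: T tape_act_def d_def)
  ultimately have "stacks (\<sigma>[i := tl (\<sigma> ! i)]) (ts[i := tape_act (Blank, if i = 0 then Right else Left) (ts ! i)])"
    using stacks_update[OF s] by (simp add: d_def)
  moreover have "i < length ts" using s assms by (simp add: stacks_def)
  ultimately show "\<exists>m ts'. m \<le> 1 \<and> exec (pop i) ts m ts' \<and> stacks (\<sigma>[i := tl (\<sigma> ! i)]) ts'"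
    using exec_act_at[of i ts "\<lambda>_. Blank"] unfolding pop_def by blast
qed

lemma runs_push:
  assumes j: "0 < j" "j < 5"
    and s: "s ((map stack_top \<sigma>)[j := Blank]) = x" and x: "x \<noteq> Blank"
  shows "runs (push j s) \<sigma> 3 (\<sigma>[j := x # \<sigma> ! j])"
  unfolding runs_def
proof (intro allI impI)
  fix ts assume st: "stacks \<sigma> ts"
  have len: "j < length ts" "length \<sigma> = length ts" "j < length (ts[j := u])" for u
    using st j by (auto simp: stacks_def)
  obtain t h where T: "ts ! j = (t, h)" by fastforce
  have tape: "stack_tape 1 (\<sigma> ! j) (t, h)" using st j T by (auto simp: stacks_def dest: spec[of _ j])
  have pos: "t (h - int i) = (if i < length (\<sigma> ! j) then \<sigma> ! j ! i else Blank)" for i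
    using tape by (auto simp: stack_tape_def)
  have above: "t (h + 1 + int i) = Blank" for i
    using tape by (auto simp: stack_tape_def add.assoc)
  let ?T1 = "(t, h + 1)" and ?T2 = "(t(h + 1 := x), h + 1)"
  have a1: "tape_act (map tape_read ts ! j, Right) (ts ! j) = ?T1"
    using len by (simp add: T tape_act_def tape_read_def)
  have rd: "map tape_read (ts[j := ?T1]) = (map stack_top \<sigma>)[j := Blank]"
  proof -
    have "tape_read ?T1 = Blank" using above[of 0] by (simp add: tape_read_def)
    then show ?thesis by (simp add: map_update stacks_reads[OF st])
  qed
  have a2: "tape_act (s (map tape_read (ts[j := ?T1])), Stay) (ts[j := ?T1] ! j) = ?T2"
    unfolding rd s using len by (simp add: tape_act_def)
  have "stack_tape 1 (x # \<sigma> ! j) ?T2"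
  proof -
    have "(t(h + 1 := x)) (h + 1 - int i) = (if i < length (x # \<sigma> ! j) then (x # \<sigma> ! j) ! i else Blank)" for i
      using pos[of "i - 1"] by (cases i) (auto simp: nth_Cons)
    moreover have "(t(h + 1 := x)) (h + 1 + int (Suc i)) = Blank" for i
      using above[of "Suc i"] by auto
    moreover have "Blank \<notin> set (x # \<sigma> ! j)" using tape x by (auto simp: stack_tape_def)
    ultimately show ?thesis by (simp add: stack_tape_def)
  qed
  then have "stacks (\<sigma>[j := x # \<sigma> ! j]) (ts[j := ?T2])"
    using stacks_update[OF st, of j] j by simp
  moreover have "exec (push j s) ts (1 + 1 + 1) (ts[j := ?T2])"
    unfolding push_def
    using exec_Seq[OF exec_act_at[of j ts "\<lambda>as. as ! j" Right, unfolded a1]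
        exec_act_at[of j "ts[j := ?T1]" s Stay, unfolded a2]] len by simp
  ultimately show "\<exists>m ts'. m \<le> 3 \<and> exec (push j s) ts m ts' \<and> stacks (\<sigma>[j := x # \<sigma> ! j]) ts'"
    by (intro exI[of _ "1 + 1 + 1"] exI[of _ "ts[j := ?T2]"]) simp
qed

lemma pop_wf: "i < 5 \<Longrightarrow> prog_wf 5 syms (pop i)"
  unfolding pop_def by (rule act_at_wf) (auto simp: syms_def)

lemma push_wf:
  "j < 5 \<Longrightarrow> (\<And>as. length as = 5 \<Longrightarrow> set as \<subseteq> syms \<Longrightarrow> s as \<in> syms) \<Longrightarrow> prog_wf 5 syms (push j s)"
  unfolding push_def by (auto intro!: act_at_wf)

section \<open>Transferring, copying and erasing whole stacks\<close>

definition mv :: "nat \<Rightarrow> nat \<Rightarrow> token prog" where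
  "mv i j = Seq (push j (\<lambda>as. as ! i)) (pop i)"

lemma mv_wf: "i < 5 \<Longrightarrow> j < 5 \<Longrightarrow> prog_wf 5 syms (mv i j)"
  unfolding mv_def by (auto intro!: push_wf pop_wf)

lemma runs_mv:
  assumes "i < 5" "0 < j" "j < 5" "i \<noteq> j" "\<sigma> ! i = x # xs"
  shows "runs (mv i j) \<sigma> 5 (\<sigma>[i := xs, j := x # \<sigma> ! j])"
proof (rule runs_no_Blank)
  assume len: "length \<sigma> = 5" and nb: "\<And>i. i < 5 \<Longrightarrow> Blank \<notin> set (\<sigma> ! i)"
  have "x \<noteq> Blank" using nb[OF assms(1)] by (metis assms(5) list.set_intros(1))
  with assms len have "runs (push j (\<lambda>as. as ! i)) \<sigma> 3 (\<sigma>[j := x # \<sigma> ! j])"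
    by (intro runs_push) auto
  from runs_Seq[OF this runs_pop[OF assms(1)]] show "runs (mv i j) \<sigma> 5 (\<sigma>[i := xs, j := x # \<sigma> ! j])"
    using assms len by (simp add: mv_def list_update_swap)
qed

definition mv_all :: "nat \<Rightarrow> nat \<Rightarrow> token prog" where
  "mv_all i j = Loop (\<lambda>as. as ! i \<noteq> Blank) (mv i j)"

lemma runs_mv_all:
  assumes "i < 5" "0 < j" "j < 5" "i \<noteq> j"
  shows "runs (mv_all i j) \<sigma> (1 + 6 * length (\<sigma> ! i)) (\<sigma>[i := [], j := rev (\<sigma> ! i) @ \<sigma> ! j])"
proof (induction "\<sigma> ! i" arbitrary: \<sigma>)
  case Nil
  show ?case
  proof (rule runs_no_Blank)
    assume "length \<sigma> = 5"
    then have "\<not> map stack_top \<sigma> ! i \<noteq> Blank" using assms Nil[symmetric] by simp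
    from runs_Loop_stop[where b = "\<lambda>as. as ! i \<noteq> Blank", OF this]
    have "runs (mv_all i j) \<sigma> 1 \<sigma>" by (simp add: mv_all_def)
    moreover have "\<sigma>[i := [], j := rev (\<sigma> ! i) @ \<sigma> ! j] = \<sigma>"
      by (metis Nil append_Nil list_update_id rev.simps(1))
    ultimately show "runs (mv_all i j) \<sigma> (1 + 6 * length (\<sigma> ! i)) (\<sigma>[i := [], j := rev (\<sigma> ! i) @ \<sigma> ! j])"
      by (simp flip: Nil)
  qed
next
  case (Cons x xs)
  show ?case
  proof (rule runs_no_Blank)
    assume len: "length \<sigma> = 5" and nb: "\<And>i. i < 5 \<Longrightarrow> Blank \<notin> set (\<sigma> ! i)"
    let ?\<sigma> = "\<sigma>[i := xs, j := x # \<sigma> ! j]"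
    have "x \<noteq> Blank" using nb[OF assms(1)] by (metis Cons(2) list.set_intros(1))
    then have "map stack_top \<sigma> ! i \<noteq> Blank" using assms len by (simp flip: Cons(2))
    moreover have "xs = ?\<sigma> ! i" using len assms by simp
    note IH = Cons(1)[OF this]
    ultimately have "runs (mv_all i j) \<sigma> (1 + 5 + (1 + 6 * length (?\<sigma> ! i)))
       (?\<sigma>[i := [], j := rev (?\<sigma> ! i) @ ?\<sigma> ! j])"
      unfolding mv_all_def by (intro runs_Loop_step[OF _ runs_mv[OF assms]]) (use Cons(2) in auto)
    then show "runs (mv_all i j) \<sigma> (1 + 6 * length (\<sigma> ! i)) (\<sigma>[i := [], j := rev (\<sigma> ! i) @ \<sigma> ! j])"
      using len assms by (simp add: list_update_swap flip: Cons(2))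
  qed
qed

definition cp_all :: "nat \<Rightarrow> nat \<Rightarrow> nat \<Rightarrow> token prog" where
  "cp_all i j k = Loop (\<lambda>as. as ! i \<noteq> Blank) (Seq (push k (\<lambda>as. as ! i)) (mv i j))"

lemma runs_cp_all:
  assumes "i < 5" "0 < j" "j < 5" "i \<noteq> j" "0 < k" "k < 5" "i \<noteq> k" "j \<noteq> k"
  shows "runs (cp_all i j k) \<sigma> (1 + 10 * length (\<sigma> ! i))
    (\<sigma>[i := [], j := rev (\<sigma> ! i) @ \<sigma> ! j, k := rev (\<sigma> ! i) @ \<sigma> ! k])"
proof (induction "\<sigma> ! i" arbitrary: \<sigma>)
  case Nil
  show ?case
  proof (rule runs_no_Blank)
    assume "length \<sigma> = 5"
    then have "\<not> map stack_top \<sigma> ! i \<noteq> Blank" using assms Nil[symmetric] by simp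
    from runs_Loop_stop[where b = "\<lambda>as. as ! i \<noteq> Blank", OF this]
    have "runs (cp_all i j k) \<sigma> 1 \<sigma>" by (simp add: cp_all_def)
    moreover have "\<sigma>[i := [], j := rev (\<sigma> ! i) @ \<sigma> ! j, k := rev (\<sigma> ! i) @ \<sigma> ! k] = \<sigma>"
      by (metis Nil append_Nil list_update_id rev.simps(1))
    ultimately show "runs (cp_all i j k) \<sigma> (1 + 10 * length (\<sigma> ! i))
      (\<sigma>[i := [], j := rev (\<sigma> ! i) @ \<sigma> ! j, k := rev (\<sigma> ! i) @ \<sigma> ! k])"
      by (simp flip: Nil)
  qed
next
  case (Cons x xs)
  show ?case
  proof (rule runs_no_Blank)
    assume len: "length \<sigma> = 5" and nb: "\<And>i. i < 5 \<Longrightarrow> Blank \<notin> set (\<sigma> ! i)"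
    have x: "x \<noteq> Blank" using nb[OF assms(1)] by (metis Cons(2) list.set_intros(1))
    let ?\<sigma>' = "\<sigma>[k := x # \<sigma> ! k]"
    let ?\<sigma> = "?\<sigma>'[i := xs, j := x # ?\<sigma>' ! j]"
    have 1: "map stack_top \<sigma> ! i \<noteq> Blank" using assms x len by (simp flip: Cons(2))
    have 2: "runs (push k (\<lambda>as. as ! i)) \<sigma> 3 ?\<sigma>'"
      using x len assms by (intro runs_push) (auto simp flip: Cons(2))
    have 3: "runs (mv i j) ?\<sigma>' 5 ?\<sigma>"
      using assms len by (intro runs_mv) (auto simp flip: Cons(2))
    have "xs = ?\<sigma> ! i" using len assms by simp
    note IH = Cons(1)[OF this]
    with 1 have "runs (cp_all i j k) \<sigma> (1 + (1 + 3 + 5) + (1 + 10 * length (?\<sigma> ! i)))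
       (?\<sigma>[i := [], j := rev (?\<sigma> ! i) @ ?\<sigma> ! j, k := rev (?\<sigma> ! i) @ ?\<sigma> ! k])"
      unfolding cp_all_def by (intro runs_Loop_step[OF _ runs_Seq[OF 2 3]]) auto
    moreover have "?\<sigma>[i := [], j := rev (?\<sigma> ! i) @ ?\<sigma> ! j, k := rev (?\<sigma> ! i) @ ?\<sigma> ! k] =
      \<sigma>[i := [], j := rev (\<sigma> ! i) @ \<sigma> ! j, k := rev (\<sigma> ! i) @ \<sigma> ! k]"
      by (rule nth_equalityI) (use len assms in \<open>auto simp: nth_list_update simp flip: Cons(2)\<close>)
    ultimately show "runs (cp_all i j k) \<sigma> (1 + 10 * length (\<sigma> ! i))
      (\<sigma>[i := [], j := rev (\<sigma> ! i) @ \<sigma> ! j, k := rev (\<sigma> ! i) @ \<sigma> ! k])"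
      using len assms by (simp flip: Cons(2))
  qed
qed

definition clear :: "nat \<Rightarrow> token prog" where
  "clear i = Loop (\<lambda>as. as ! i \<noteq> Blank) (pop i)"

lemma runs_clear:
  assumes "i < 5"
  shows "runs (clear i) \<sigma> (1 + 2 * length (\<sigma> ! i)) (\<sigma>[i := []])"
proof (induction "\<sigma> ! i" arbitrary: \<sigma>)
  case Nil
  show ?case
  proof (rule runs_no_Blank)
    assume "length \<sigma> = 5"
    then have "\<not> map stack_top \<sigma> ! i \<noteq> Blank" using assms Nil[symmetric] by simp
    from runs_Loop_stop[where b = "\<lambda>as. as ! i \<noteq> Blank", OF this]
    have "runs (clear i) \<sigma> 1 \<sigma>" by (simp add: clear_def)
    moreover have "\<sigma>[i := []] = \<sigma>" by (metis Nil list_update_id)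
    ultimately show "runs (clear i) \<sigma> (1 + 2 * length (\<sigma> ! i)) (\<sigma>[i := []])"
      by (simp flip: Nil)
  qed
next
  case (Cons x xs)
  show ?case
  proof (rule runs_no_Blank)
    assume len: "length \<sigma> = 5" and nb: "\<And>i. i < 5 \<Longrightarrow> Blank \<notin> set (\<sigma> ! i)"
    let ?\<sigma> = "\<sigma>[i := tl (\<sigma> ! i)]"
    have "x \<noteq> Blank" using nb[OF assms(1)] by (metis Cons(2) list.set_intros(1))
    then have 1: "map stack_top \<sigma> ! i \<noteq> Blank" using assms len by (simp flip: Cons(2))
    have "xs = ?\<sigma> ! i" using len assms by (simp flip: Cons(2))
    note IH = Cons(1)[OF this]
    with 1 have "runs (clear i) \<sigma> (1 + 1 + (1 + 2 * length (?\<sigma> ! i))) (?\<sigma>[i := []])"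
      unfolding clear_def by (intro runs_Loop_step[OF _ runs_pop[OF assms]]) auto
    then show "runs (clear i) \<sigma> (1 + 2 * length (\<sigma> ! i)) (\<sigma>[i := []])"
      using len assms by (simp flip: Cons(2))
  qed
qed

lemma mv_all_wf: "i < 5 \<Longrightarrow> j < 5 \<Longrightarrow> prog_wf 5 syms (mv_all i j)"
  by (simp add: mv_all_def mv_wf)

lemma cp_all_wf: "i < 5 \<Longrightarrow> j < 5 \<Longrightarrow> k < 5 \<Longrightarrow> prog_wf 5 syms (cp_all i j k)"
  by (auto simp: cp_all_def mv_wf intro!: push_wf)

lemma clear_wf: "i < 5 \<Longrightarrow> prog_wf 5 syms (clear i)"
  by (simp add: clear_def pop_wf)

section \<open>Polynomial-time functions on tree-encoded data\<close>

datatype tree = TNil | TLeaf token | TNode tree tree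

text \<open>Preorder notation is a prefix code: a tree on top of a stack needs no end marker, so
  several values can share one stack.\<close>

fun code :: "tree \<Rightarrow> sym list" where
  "code TNil = [Aux 1]"
| "code (TLeaf t) = [Inp t]"
| "code (TNode a b) = Aux 0 # code a @ code b"

abbreviation tsize :: "tree \<Rightarrow> nat" where
  "tsize t \<equiv> length (code t)"

fun is_node :: "tree \<Rightarrow> bool" where
  "is_node (TNode a b) = True"
| "is_node _ = False"

definition tbool :: "bool \<Rightarrow> tree" where
  "tbool b = (if b then TNode TNil TNil else TNil)"

lemma code_not_Blank: "Blank \<notin> set (code t)"
  by (induction t) auto

lemma tsize_pos: "1 \<le> tsize t"
  by (cases t) auto

lemma stack_top_code: "stack_top (code t @ r) = Aux 0 \<longleftrightarrow> is_node t"
  by (cases t) auto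

lemma code_append_inject: "code a @ r = code b @ s \<Longrightarrow> a = b \<and> r = s"
proof (induction a arbitrary: b r s)
  case TNil
  then show ?case by (cases b) auto
next
  case (TLeaf t)
  then show ?case by (cases b) auto
next
  case (TNode a1 a2)
  from TNode.prems obtain b1 b2 where b: "b = TNode b1 b2" by (cases b) auto
  with TNode.prems have "code a1 @ (code a2 @ r) = code b1 @ (code b2 @ s)" by simp
  from TNode.IH(1)[OF this] have a1: "a1 = b1" and "code a2 @ r = code b2 @ s" by auto
  from TNode.IH(2)[OF this(2)] a1 b show ?case by simp
qed

lemma code_inject: "code a = code b \<longleftrightarrow> a = b"
  using code_append_inject[of a "[]" b "[]"] by auto

text \<open>In preorder notation a node symbol replaces one outstanding tree by two, and every other
  symbol completes one; the tree has been read exactly when nothing is outstanding.\<close>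

definition mv_tree :: "nat \<Rightarrow> token prog" where
  "mv_tree j = Seq (push 4 (\<lambda>_. Aux 1)) (Loop (\<lambda>as. as ! 4 \<noteq> Blank)
     (Cond (\<lambda>as. as ! 1 = Aux 0) (Seq (mv 1 j) (push 4 (\<lambda>_. Aux 1))) (Seq (mv 1 j) (pop 4))))"

text \<open>Tape 4 counts in unary how many trees are still to be read.\<close>

lemma runs_mv_forest:
  assumes "j = 2 \<or> j = 3" "length \<sigma> = 5"
    and "\<sigma> ! 1 = concat (map code F) @ r" "\<sigma> ! 4 = replicate (length F) (Aux 1)"
  shows "runs (Loop (\<lambda>as. as ! 4 \<noteq> Blank)
     (Cond (\<lambda>as. as ! 1 = Aux 0) (Seq (mv 1 j) (push 4 (\<lambda>_. Aux 1))) (Seq (mv 1 j) (pop 4))))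
     \<sigma> (1 + 11 * length (concat (map code F)))
     (\<sigma>[1 := r, j := rev (concat (map code F)) @ \<sigma> ! j, 4 := []])"
    (is "runs (Loop ?b ?c) _ _ _")
  using assms(2-)
proof (induction "length (concat (map code F))" arbitrary: F \<sigma> rule: less_induct)
  case less
  show ?case
  proof (cases F)
    case Nil
    then have "\<sigma>[1 := r, j := rev (concat (map code F)) @ \<sigma> ! j, 4 := []] = \<sigma>"
      by (intro nth_equalityI) (use less.prems in \<open>auto simp: nth_list_update\<close>)
    with runs_Loop_stop[of ?b \<sigma> ?c] less.prems Nil show ?thesis by simp
  next
    case (Cons t F')
    define s where "s = hd (code t)"
    \<comment> \<open>\<open>G\<close> is the forest outstanding after the first symbol: the
      children of a node take its place. It may have more trees than \<open>F\<close>, so the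
      induction is on the length of the code.\<close>
    define G where "G = (case t of TNode a b \<Rightarrow> a # b # F' | _ \<Rightarrow> F')"
    define \<sigma>' where "\<sigma>' = \<sigma>[1 := concat (map code G) @ r, j := s # \<sigma> ! j, 4 := replicate (length G) (Aux 1)]"
    have s: "concat (map code F) = s # concat (map code G)"
      by (cases t) (auto simp: Cons s_def G_def)
    have G: "length G = (if is_node t then length F + 1 else length F - 1)"
      by (cases t) (auto simp: Cons G_def)
    have node: "s = Aux 0 \<longleftrightarrow> is_node t" by (cases t) (auto simp: s_def)
    have mv: "runs (mv 1 j) \<sigma> 5 (\<sigma>[1 := concat (map code G) @ r, j := s # \<sigma> ! j])"
      using assms(1) less.prems s by (intro runs_mv) auto
    have "runs (if (\<lambda>as. as ! 1 = Aux 0) (map stack_top \<sigma>) then Seq (mv 1 j) (push 4 (\<lambda>_. Aux 1)) else Seq (mv 1 j) (pop 4)) \<sigma> 9 \<sigma>'"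
    proof (cases "is_node t")
      case True
      have "runs (push 4 (\<lambda>_. Aux 1)) (\<sigma>[1 := concat (map code G) @ r, j := s # \<sigma> ! j]) 3
         ((\<sigma>[1 := concat (map code G) @ r, j := s # \<sigma> ! j])[4 := Aux 1 # \<sigma>[1 := concat (map code G) @ r, j := s # \<sigma> ! j] ! 4])"
        by (rule runs_push) auto
      moreover have "(\<sigma>[1 := concat (map code G) @ r, j := s # \<sigma> ! j])[4 := Aux 1 # \<sigma>[1 := concat (map code G) @ r, j := s # \<sigma> ! j] ! 4] = \<sigma>'"
        unfolding \<sigma>'_def using assms(1) less.prems G True by auto
      ultimately show ?thesis
        using runs_Seq[OF mv, of "push 4 (\<lambda>_. Aux 1)" 3 \<sigma>'] True node s less.prems by simp
    next
      case False
      have "runs (pop 4) (\<sigma>[1 := concat (map code G) @ r, j := s # \<sigma> ! j]) 1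
         ((\<sigma>[1 := concat (map code G) @ r, j := s # \<sigma> ! j])[4 := tl (\<sigma>[1 := concat (map code G) @ r, j := s # \<sigma> ! j] ! 4)])"
        by (rule runs_pop) auto
      moreover have "(\<sigma>[1 := concat (map code G) @ r, j := s # \<sigma> ! j])[4 := tl (\<sigma>[1 := concat (map code G) @ r, j := s # \<sigma> ! j] ! 4)] = \<sigma>'"
        unfolding \<sigma>'_def using assms(1) less.prems G False Cons by auto
      ultimately show ?thesis
        using runs_mono[OF runs_Seq[OF mv, of "pop 4" 1 \<sigma>'], of 9] False node s less.prems by simp
    qed
    from runs_Cond[where b = "\<lambda>as. as ! 1 = Aux 0", OF this] have body: "runs ?c \<sigma> 10 \<sigma>'" by simp
    have "runs (Loop ?b ?c) \<sigma>' (1 + 11 * length (concat (map code G)))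
      (\<sigma>'[1 := r, j := rev (concat (map code G)) @ \<sigma>' ! j, 4 := []])"
      by (rule less.hyps) (use s less.prems assms(1) in \<open>auto simp: \<sigma>'_def\<close>)
    moreover have "\<sigma>'[1 := r, j := rev (concat (map code G)) @ \<sigma>' ! j, 4 := []] =
        \<sigma>[1 := r, j := rev (concat (map code F)) @ \<sigma> ! j, 4 := []]"
      unfolding \<sigma>'_def
      by (intro nth_equalityI) (use s less.prems assms(1) in \<open>auto simp: nth_list_update\<close>)
    moreover have "?b (map stack_top \<sigma>)" using less.prems Cons by simp
    ultimately have "runs (Loop ?b ?c) \<sigma> (1 + 10 + (1 + 11 * length (concat (map code G))))
      (\<sigma>[1 := r, j := rev (concat (map code F)) @ \<sigma> ! j, 4 := []])"
      using runs_Loop_step[where b = ?b, OF _ body] by metis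
    then show ?thesis by (simp add: s)
  qed
qed

lemma runs_mv_tree:
  assumes "j = 2 \<or> j = 3" "length \<sigma> = 5" "\<sigma> ! 1 = code t @ r" "\<sigma> ! 4 = []"
  shows "runs (mv_tree j) \<sigma> (5 + 11 * tsize t) (\<sigma>[1 := r, j := rev (code t) @ \<sigma> ! j])"
proof -
  let ?\<sigma> = "\<sigma>[4 := [Aux 1]]"
  have 1: "runs (push 4 (\<lambda>_. Aux 1)) \<sigma> 3 ?\<sigma>"
    using runs_push[of 4 "\<lambda>_. Aux 1" \<sigma> "Aux 1"] assms by simp
  have "?\<sigma>[1 := r, j := rev (concat (map code [t])) @ ?\<sigma> ! j, 4 := []] = \<sigma>[1 := r, j := rev (code t) @ \<sigma> ! j]"
    by (intro nth_equalityI) (use assms in \<open>auto simp: nth_list_update\<close>)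
  with runs_Seq[OF 1 runs_mv_forest[of j ?\<sigma> "[t]" r]] assms show ?thesis
    unfolding mv_tree_def by simp
qed

abbreviation st :: "sym list \<Rightarrow> sym list \<Rightarrow> sym list list" where
  "st a m \<equiv> [a, m, [], [], []]"

lemma mv_tree_wf: "j < 5 \<Longrightarrow> prog_wf 5 syms (mv_tree j)"
  by (auto simp: mv_tree_def syms_def[symmetric] intro!: push_wf mv_wf pop_wf) (auto simp: syms_def)

definition drop_tree :: "token prog" where
  "drop_tree = Seq (mv_tree 2) (clear 2)"

text \<open>Moving a stack reverses it, so the second copy goes back through tape 2 to arrive in
  reading order.\<close>

definition dup_tree :: "token prog" where
  "dup_tree = Seq (mv_tree 2) (Seq (cp_all 2 1 3) (Seq (mv_all 3 2) (mv_all 2 1)))"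

definition swap_trees :: "token prog" where
  "swap_trees = Seq (mv_tree 2) (Seq (mv_tree 3) (Seq (mv_all 2 1) (mv_all 3 1)))"

lemma tree_progs_wf [simp]: "prog_wf 5 syms drop_tree" "prog_wf 5 syms dup_tree" "prog_wf 5 syms swap_trees"
  by (simp_all add: drop_tree_def dup_tree_def swap_trees_def mv_tree_wf mv_all_wf cp_all_wf clear_wf)

lemma runs_drop_tree: "runs drop_tree (st a (code t @ r)) (7 + 13 * tsize t) (st a r)"
proof -
  have "runs (mv_tree 2) (st a (code t @ r)) (5 + 11 * tsize t) [a, r, rev (code t), [], []]"
    using runs_mv_tree[of 2 "st a (code t @ r)" t r] by (simp add: numeral_eq_Suc)
  moreover have "runs (clear 2) [a, r, rev (code t), [], []] (1 + 2 * tsize t) (st a r)"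
    using runs_clear[of 2 "[a, r, rev (code t), [], []]"] by (simp add: numeral_eq_Suc)
  ultimately show ?thesis
    unfolding drop_tree_def by (rule runs_mono[OF runs_Seq]) simp
qed

lemma runs_dup_tree:
  "runs dup_tree (st a (code t @ r)) (11 + 33 * tsize t) (st a (code t @ code t @ r))"
proof -
  have 1: "runs (mv_tree 2) (st a (code t @ r)) (5 + 11 * tsize t) [a, r, rev (code t), [], []]"
    using runs_mv_tree[of 2 "st a (code t @ r)" t r] by (simp add: numeral_eq_Suc)
  have 2: "runs (cp_all 2 1 3) [a, r, rev (code t), [], []] (1 + 10 * tsize t)
      [a, code t @ r, [], code t, []]"
    using runs_cp_all[of 2 1 3 "[a, r, rev (code t), [], []]"] by (simp add: numeral_eq_Suc)
  have 3: "runs (mv_all 3 2) [a, code t @ r, [], code t, []] (1 + 6 * tsize t)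
      [a, code t @ r, rev (code t), [], []]"
    using runs_mv_all[of 3 2 "[a, code t @ r, [], code t, []]"] by (simp add: numeral_eq_Suc)
  have 4: "runs (mv_all 2 1) [a, code t @ r, rev (code t), [], []] (1 + 6 * tsize t)
      (st a (code t @ code t @ r))"
    using runs_mv_all[of 2 1 "[a, code t @ r, rev (code t), [], []]"] by (simp add: numeral_eq_Suc)
  show ?thesis
    unfolding dup_tree_def by (rule runs_mono[OF runs_Seq[OF 1 runs_Seq[OF 2 runs_Seq[OF 3 4]]]]) simp
qed

lemma runs_swap_trees:
  "runs swap_trees (st a (code t @ code u @ r)) (15 + 17 * (tsize t + tsize u)) (st a (code u @ code t @ r))"
proof -
  have 1: "runs (mv_tree 2) (st a (code t @ code u @ r)) (5 + 11 * tsize t)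
      [a, code u @ r, rev (code t), [], []]"
    using runs_mv_tree[of 2 "st a (code t @ code u @ r)" t "code u @ r"] by (simp add: numeral_eq_Suc)
  have 2: "runs (mv_tree 3) [a, code u @ r, rev (code t), [], []] (5 + 11 * tsize u)
      [a, r, rev (code t), rev (code u), []]"
    using runs_mv_tree[of 3 "[a, code u @ r, rev (code t), [], []]" u r] by (simp add: numeral_eq_Suc)
  have 3: "runs (mv_all 2 1) [a, r, rev (code t), rev (code u), []] (1 + 6 * tsize t)
      [a, code t @ r, [], rev (code u), []]"
    using runs_mv_all[of 2 1 "[a, r, rev (code t), rev (code u), []]"] by (simp add: numeral_eq_Suc)
  have 4: "runs (mv_all 3 1) [a, code t @ r, [], rev (code u), []] (1 + 6 * tsize u)
      (st a (code u @ code t @ r))"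
    using runs_mv_all[of 3 1 "[a, code t @ r, [], rev (code u), []]"] by (simp add: numeral_eq_Suc)
  show ?thesis
    unfolding swap_trees_def by (rule runs_mono[OF runs_Seq[OF 1 runs_Seq[OF 2 runs_Seq[OF 3 4]]]]) simp
qed

abbreviation push_main :: "sym \<Rightarrow> token prog" where
  "push_main x \<equiv> push (Suc 0) (\<lambda>_. x)"

abbreviation pop_main :: "token prog" where
  "pop_main \<equiv> pop (Suc 0)"

lemma syms_simps [simp]: "Blank \<in> syms" "Aux 0 \<in> syms" "Aux (Suc 0) \<in> syms" "Inp t \<in> syms"
  by (auto simp: syms_def)

lemma main_wf [simp]: "x \<in> syms \<Longrightarrow> prog_wf 5 syms (push_main x)" "prog_wf 5 syms pop_main"
  by (auto intro!: push_wf pop_wf)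

lemma runs_push_main:
  assumes "x \<noteq> Blank"
  shows "runs (push_main x) (st a m) 3 (st a (x # m))"
  using runs_push[of 1 "\<lambda>_. x" "st a m" x] assms by simp

lemma runs_pop_main: "runs pop_main (st a (x # m)) 1 (st a m)"
  using runs_pop[of 1 "st a (x # m)"] by simp

definition eq_loop :: "token prog" where
  "eq_loop = Loop (\<lambda>as. as ! 2 \<noteq> Blank \<and> as ! 2 = as ! 3) (Seq (pop 2) (pop 3))"

text \<open>Equal tops are removed as long as possible, so both stacks are exhausted only for equal
  words. The remainders are no longer than the originals, which bounds the cost of clearing them
  afterwards.\<close>

lemma runs_eq_loop:
  assumes "Blank \<notin> set xs"
  shows "\<exists>xs' ys'. runs eq_loop [a, m, xs, ys, []] (1 + 4 * length xs) [a, m, xs', ys', []] \<and>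
    length xs' \<le> length xs \<and> length ys' \<le> length ys \<and> (xs' = [] \<and> ys' = [] \<longleftrightarrow> xs = ys)"
  using assms
proof (induction xs arbitrary: ys)
  case Nil
  have "runs eq_loop [a, m, [], ys, []] 1 [a, m, [], ys, []]"
    unfolding eq_loop_def by (rule runs_Loop_stop) (simp add: numeral_eq_Suc)
  then show ?case by auto
next
  case (Cons x xs)
  show ?case
  proof (cases "stack_top ys = x")
    case True
    with Cons.prems obtain zs where ys: "ys = x # zs" by (cases ys) auto
    obtain xs' ys' where IH: "runs eq_loop [a, m, xs, zs, []] (1 + 4 * length xs) [a, m, xs', ys', []]"
      "length xs' \<le> length xs" "length ys' \<le> length zs" "xs' = [] \<and> ys' = [] \<longleftrightarrow> xs = zs"
      using Cons.IH[of zs] Cons.prems by auto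
    have p2: "runs (pop 2) [a, m, x # xs, ys, []] 1 [a, m, xs, ys, []]"
      using runs_pop[of 2 "[a, m, x # xs, ys, []]"] by (simp add: numeral_eq_Suc)
    have p3: "runs (pop 3) [a, m, xs, ys, []] 1 [a, m, xs, zs, []]"
      using runs_pop[of 3 "[a, m, xs, ys, []]"] by (simp add: numeral_eq_Suc ys)
    have "runs eq_loop [a, m, x # xs, ys, []] (1 + (1 + 1 + 1) + (1 + 4 * length xs)) [a, m, xs', ys', []]"
      unfolding eq_loop_def
      by (rule runs_Loop_step[OF _ runs_Seq[OF p2 p3] IH(1)[unfolded eq_loop_def]])
        (use Cons.prems True in \<open>auto simp: numeral_eq_Suc\<close>)
    then have "runs eq_loop [a, m, x # xs, ys, []] (1 + 4 * length (x # xs)) [a, m, xs', ys', []]"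
      by (rule runs_mono) simp
    then show ?thesis using IH(2-) ys by (intro exI[of _ xs'] exI[of _ ys']) auto
  next
    case False
    have "runs eq_loop [a, m, x # xs, ys, []] 1 [a, m, x # xs, ys, []]"
      unfolding eq_loop_def by (rule runs_Loop_stop) (use False in \<open>simp add: numeral_eq_Suc\<close>)
    then have "runs eq_loop [a, m, x # xs, ys, []] (1 + 4 * length (x # xs)) [a, m, x # xs, ys, []]"
      by (rule runs_mono) simp
    then show ?thesis using False by fastforce
  qed
qed

section \<open>Polynomial bounds\<close>

definition poly_bounded :: "(nat \<Rightarrow> nat) \<Rightarrow> bool" where
  "poly_bounded b \<longleftrightarrow> (\<exists>p. \<forall>n. b n \<le> poly p n)"

text \<open>The coefficients are natural numbers, so no term can decrease. Through this, a bound on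
  the size of an intermediate result becomes a bound on the time of the next program.\<close>

lemma poly_nat_mono: "m \<le> n \<Longrightarrow> poly (p :: nat poly) m \<le> poly p n"
  by (induction p) (auto intro!: add_mono mult_mono)

lemma poly_bounded_poly: "poly_bounded (poly p)"
  by (auto simp: poly_bounded_def)

lemma poly_bounded_const: "poly_bounded (\<lambda>_. c)"
  unfolding poly_bounded_def by (rule exI[of _ "[:c:]"]) simp

lemma poly_bounded_id: "poly_bounded (\<lambda>n. n)"
  unfolding poly_bounded_def by (rule exI[of _ "[:0, 1:]"]) simp

lemma poly_bounded_add:
  assumes "poly_bounded b" "poly_bounded c"
  shows "poly_bounded (\<lambda>n. b n + c n)"
proof -
  obtain p q where "\<forall>n. b n \<le> poly p n" "\<forall>n. c n \<le> poly q n"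
    using assms by (auto simp: poly_bounded_def)
  then have "\<forall>n. b n + c n \<le> poly (p + q) n" by (simp add: add_mono)
  then show ?thesis unfolding poly_bounded_def by blast
qed

lemma poly_bounded_mult:
  assumes "poly_bounded b" "poly_bounded c"
  shows "poly_bounded (\<lambda>n. b n * c n)"
proof -
  obtain p q where "\<forall>n. b n \<le> poly p n" "\<forall>n. c n \<le> poly q n"
    using assms by (auto simp: poly_bounded_def)
  then have "\<forall>n. b n * c n \<le> poly (p * q) n" by (simp add: mult_mono)
  then show ?thesis unfolding poly_bounded_def by blast
qed

lemma poly_bounded_comp:
  assumes "poly_bounded b"
  shows "poly_bounded (\<lambda>n. poly p (b n))"
proof -
  obtain q where "\<forall>n. b n \<le> poly q n" using assms by (auto simp: poly_bounded_def)
  then have "\<forall>n. poly p (b n) \<le> poly (pcompose p q) n" by (simp add: poly_pcompose poly_nat_mono)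
  then show ?thesis unfolding poly_bounded_def by blast
qed

lemmas poly_bounded_intros = poly_bounded_poly poly_bounded_const poly_bounded_id
  poly_bounded_add poly_bounded_mult poly_bounded_comp

text \<open>Injectivity is what makes the comparison of codes a test for equality.\<close>

class tree_enc =
  fixes to_tree :: "'a \<Rightarrow> tree"
  assumes to_tree_inject: "to_tree x = to_tree y \<longleftrightarrow> x = y"

abbreviation esize :: "'a::tree_enc \<Rightarrow> nat" where
  "esize x \<equiv> tsize (to_tree x)"

instantiation token :: tree_enc
begin
definition "to_tree_token = TLeaf"
instance by standard (simp add: to_tree_token_def)
end

instantiation bool :: tree_enc
begin
definition "to_tree_bool b = (if b then TNode TNil TNil else TNil)"
instance by standard (simp add: to_tree_bool_def)
end

instantiation prod :: (tree_enc, tree_enc) tree_enc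
begin
definition "to_tree_prod p = TNode (to_tree (fst p)) (to_tree (snd p))"
instance by standard (auto simp: to_tree_prod_def to_tree_inject prod_eq_iff)
end

instantiation list :: (tree_enc) tree_enc
begin
primrec to_tree_list :: "'a list \<Rightarrow> tree" where
  "to_tree_list [] = TNil"
| "to_tree_list (x # xs) = TNode (to_tree x) (to_tree_list xs)"
instance
proof
  fix xs ys :: "'a list"
  show "to_tree xs = to_tree ys \<longleftrightarrow> xs = ys"
  proof (induction xs arbitrary: ys)
    case Nil then show ?case by (cases ys) auto
  next
    case (Cons x xs) then show ?case by (cases ys) (auto simp: to_tree_inject)
  qed
qed
end

lemma to_tree_Pair [simp]: "to_tree (x, y) = TNode (to_tree x) (to_tree y)"
  by (simp add: to_tree_prod_def)

text \<open>The input tape \<open>a\<close> and the rest \<open>r\<close> of the stack are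
  arbitrary, so programs can work on top of other data. The size of the result is bounded along with
  the time because the time of a subsequent program depends on it.\<close>

definition computes :: "token prog \<Rightarrow> ('a::tree_enc \<Rightarrow> 'b::tree_enc) \<Rightarrow> (nat \<Rightarrow> nat) \<Rightarrow> bool" where
  "computes c f b \<longleftrightarrow> prog_wf 5 syms c \<and> (\<forall>x. esize (f x) \<le> b (esize x) \<and>
     (\<forall>a r. runs c (st a (code (to_tree x) @ r)) (b (esize x)) (st a (code (to_tree (f x)) @ r))))"

definition polytime :: "('a::tree_enc \<Rightarrow> 'b::tree_enc) \<Rightarrow> bool" where
  "polytime f \<longleftrightarrow> (\<exists>c p. computes c f (poly p))"

lemma polytimeI:
  assumes "prog_wf 5 syms c" "poly_bounded b"
    and "\<And>x. esize (f x) \<le> b (esize x)"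
    and "\<And>x a r. runs c (st a (code (to_tree x) @ r)) (b (esize x)) (st a (code (to_tree (f x)) @ r))"
  shows "polytime f"
proof -
  obtain p where "\<And>n. b n \<le> poly p n" using assms(2) by (auto simp: poly_bounded_def)
  then have "computes c f (poly p)"
    using assms unfolding computes_def by (meson le_trans runs_mono)
  then show ?thesis by (auto simp: polytime_def)
qed

lemma computesD:
  assumes "computes c f b"
  shows "prog_wf 5 syms c" "esize (f x) \<le> b (esize x)"
    "runs c (st a (code (to_tree x) @ r)) (b (esize x)) (st a (code (to_tree (f x)) @ r))"
  using assms by (auto simp: computes_def)

lemma polytime_comp:
  assumes "polytime g" "polytime f"
  shows "polytime (\<lambda>x. g (f x))"
proof -
  obtain c p d q where c: "computes c f (poly p)" and d: "computes d g (poly q)"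
    using assms by (auto simp: polytime_def)
  have le: "poly q (esize (f x)) \<le> poly q (poly p (esize x))" for x
    by (intro poly_nat_mono computesD(2)[OF c])
  show ?thesis
  proof (rule polytimeI[where c = "Seq c d" and b = "\<lambda>n. 1 + poly p n + poly q (poly p n)"])
    show "poly_bounded (\<lambda>n. 1 + poly p n + poly q (poly p n))"
      by (intro poly_bounded_intros)
    fix x a r
    show "esize (g (f x)) \<le> 1 + poly p (esize x) + poly q (poly p (esize x))"
      using computesD(2)[OF d, of "f x"] le[of x] by simp
    show "runs (Seq c d) (st a (code (to_tree x) @ r)) (1 + poly p (esize x) + poly q (poly p (esize x)))
        (st a (code (to_tree (g (f x))) @ r))"
      by (rule runs_mono[OF runs_Seq[OF computesD(3)[OF c] computesD(3)[OF d]]]) (use le in simp)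
  qed (simp add: computesD(1)[OF c] computesD(1)[OF d])
qed

lemma polytime_id: "polytime (\<lambda>x. x)"
proof (rule polytimeI)
  \<comment> \<open>Pushing a symbol and popping it again serves as a program that does
    nothing.\<close>
  show "prog_wf 5 syms (Seq (push_main (Aux 0)) pop_main)" by simp
  show "poly_bounded (\<lambda>n. n + 5)" by (intro poly_bounded_intros)
  show "runs (Seq (push_main (Aux 0)) pop_main) (st a (code (to_tree x) @ r)) (esize x + 5)
    (st a (code (to_tree x) @ r))" for x a r
    by (rule runs_mono[OF runs_Seq[OF runs_push_main runs_pop_main]]) auto
qed simp

lemma push_tree: "\<exists>d n. prog_wf 5 syms d \<and> (\<forall>a r. runs d (st a r) n (st a (code t @ r)))"
proof (induction t)
  case TNil
  show ?case
    by (rule exI[of _ "push_main (Aux (Suc 0))"], rule exI[of _ 3]) (simp add: runs_push_main)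
next
  case (TLeaf t)
  show ?case
    by (rule exI[of _ "push_main (Inp t)"], rule exI[of _ 3]) (simp add: runs_push_main)
next
  case (TNode t u)
  then obtain c m d n where c: "prog_wf 5 syms c" "\<And>a r. runs c (st a r) m (st a (code t @ r))"
    and d: "prog_wf 5 syms d" "\<And>a r. runs d (st a r) n (st a (code u @ r))" by blast
  have "runs (Seq d (Seq c (push_main (Aux 0)))) (st a r) (1 + n + (1 + m + 3)) (st a (code (TNode t u) @ r))"
    for a r
    using runs_Seq[OF d(2) runs_Seq[OF c(2) runs_push_main[of "Aux 0"]]] by simp
  moreover have "prog_wf 5 syms (Seq d (Seq c (push_main (Aux 0))))"
    using c d by simp
  ultimately show ?case by blast
qed

lemma polytime_const: "polytime (\<lambda>_. y)"
proof -
  obtain d n where d: "prog_wf 5 syms d" "\<And>a r. runs d (st a r) n (st a (code (to_tree y) @ r))"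
    using push_tree[of "to_tree y"] by blast
  show ?thesis
  proof (rule polytimeI[where c = "Seq drop_tree d" and b = "\<lambda>k. 1 + (7 + 13 * k) + n + esize y"])
    show "poly_bounded (\<lambda>k. 1 + (7 + 13 * k) + n + esize y)" by (intro poly_bounded_intros)
    show "runs (Seq drop_tree d) (st a (code (to_tree x) @ r)) (1 + (7 + 13 * esize x) + n + esize y)
      (st a (code (to_tree y) @ r))" for x :: 'a and a r
      by (rule runs_mono[OF runs_Seq[OF runs_drop_tree d(2)]]) simp
  qed (use d(1) in auto)
qed

lemma polytime_fst': "polytime fst"
proof (rule polytimeI)
  show "prog_wf 5 syms (Seq pop_main (Seq swap_trees drop_tree))" by simp
  show "poly_bounded (\<lambda>n. 100 * n)" by (intro poly_bounded_intros)
  fix x :: "'a \<times> 'b" and a r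
  show "esize (fst x) \<le> 100 * esize x" by (cases x) auto
  obtain y z where x: "x = (y, z)" by (cases x)
  show "runs (Seq pop_main (Seq swap_trees drop_tree)) (st a (code (to_tree x) @ r)) (100 * esize x)
      (st a (code (to_tree (fst x)) @ r))"
    unfolding x fst_conv to_tree_Pair code.simps append.simps append_assoc
    by (rule runs_mono[OF runs_Seq[OF runs_pop_main runs_Seq[OF runs_swap_trees runs_drop_tree]]]) simp
qed

lemma polytime_snd': "polytime snd"
proof (rule polytimeI)
  show "prog_wf 5 syms (Seq pop_main drop_tree)" by simp
  show "poly_bounded (\<lambda>n. 100 * n)" by (intro poly_bounded_intros)
  fix x :: "'a \<times> 'b" and a r
  show "esize (snd x) \<le> 100 * esize x" by (cases x) auto
  obtain y z where x: "x = (y, z)" by (cases x)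
  show "runs (Seq pop_main drop_tree) (st a (code (to_tree x) @ r)) (100 * esize x)
      (st a (code (to_tree (snd x)) @ r))"
    unfolding x snd_conv to_tree_Pair code.simps append.simps append_assoc
    by (rule runs_mono[OF runs_Seq[OF runs_pop_main runs_drop_tree]]) simp
qed

lemma polytime_Pair:
  assumes "polytime f" "polytime g"
  shows "polytime (\<lambda>x. (f x, g x))"
proof -
  obtain c p d q where c: "computes c f (poly p)" and d: "computes d g (poly q)"
    using assms by (auto simp: polytime_def)
  \<comment> \<open>The coefficients 100 are merely generous; they cover the linear cost of copying
    and swapping trees of these sizes.\<close>
  let ?b = "\<lambda>n. 100 + 100 * n + 100 * poly p n + 100 * poly q n"
  \<comment> \<open>From the top, the stack holds \<open>x\<close> over \<open>x\<close>, then
    \<open>f x\<close> over \<open>x\<close>, \<open>x\<close> over \<open>f x\<close>,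
    \<open>g x\<close> over \<open>f x\<close>, and \<open>f x\<close> over \<open>g x\<close>; the
    node symbol turns this into a pair.\<close>
  let ?c = "Seq dup_tree (Seq c (Seq swap_trees (Seq d (Seq swap_trees (push_main (Aux 0))))))"
  show ?thesis
  proof (rule polytimeI)
    show "prog_wf 5 syms ?c" using computesD(1)[OF c] computesD(1)[OF d] by simp
    show "poly_bounded ?b" by (intro poly_bounded_intros)
    fix x a r
    have le: "esize (f x) \<le> poly p (esize x)" "esize (g x) \<le> poly q (esize x)"
      using computesD(2)[OF c] computesD(2)[OF d] by auto
    then show "esize (f x, g x) \<le> ?b (esize x)" by simp
    show "runs ?c (st a (code (to_tree x) @ r)) (?b (esize x)) (st a (code (to_tree (f x, g x)) @ r))"
      unfolding to_tree_Pair code.simps append.simps append_assoc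
      by (rule runs_mono[OF runs_Seq[OF runs_dup_tree runs_Seq[OF computesD(3)[OF c]
              runs_Seq[OF runs_swap_trees runs_Seq[OF computesD(3)[OF d]
                  runs_Seq[OF runs_swap_trees runs_push_main]]]]]]) (use le in auto)
  qed
qed

text \<open>\<open>True\<close> and nonempty lists are encoded as nodes, \<open>False\<close> and
  the empty list as \<open>TNil\<close>, so one look at the top of the main stack decides either
  case distinction.\<close>

lemma runs_Cond_main:
  assumes "runs (if is_node t then c else d) (st a (code t @ r)) n \<sigma>"
  shows "runs (Cond (\<lambda>as. as ! 1 = Aux 0) c d) (st a (code t @ r)) (1 + n) \<sigma>"
  by (rule runs_Cond) (use assms in \<open>simp add: stack_top_code\<close>)

lemma polytime_If:
  assumes "polytime b" "polytime f" "polytime g"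
  shows "polytime (\<lambda>x. if b x then f x else g x)"
proof -
  obtain c0 p0 c p d q where c0: "computes c0 b (poly p0)" and c: "computes c f (poly p)"
    and d: "computes d g (poly q)"
    using assms by (auto simp: polytime_def)
  let ?b = "\<lambda>n. 100 + 100 * n + 100 * poly p0 n + 100 * poly p n + 100 * poly q n"
  let ?c = "Seq dup_tree (Seq c0 (Cond (\<lambda>as. as ! 1 = Aux 0) (Seq drop_tree c) (Seq drop_tree d)))"
  show ?thesis
  proof (rule polytimeI)
    show "prog_wf 5 syms ?c" using computesD(1)[OF c] computesD(1)[OF d] computesD(1)[OF c0] by simp
    show "poly_bounded ?b" by (intro poly_bounded_intros)
    fix x a r
    have le: "esize (f x) \<le> poly p (esize x)" "esize (g x) \<le> poly q (esize x)"
       "esize (b x) \<le> poly p0 (esize x)"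
      using computesD(2)[OF c] computesD(2)[OF d] computesD(2)[OF c0] by auto
    then show "esize (if b x then f x else g x) \<le> ?b (esize x)" by simp
    have node: "is_node (to_tree (b x)) \<longleftrightarrow> b x" by (simp add: to_tree_bool_def)
    have "runs (if is_node (to_tree (b x)) then Seq drop_tree c else Seq drop_tree d)
       (st a (code (to_tree (b x)) @ code (to_tree x) @ r))
       (8 + 13 * esize (b x) + poly p (esize x) + poly q (esize x))
       (st a (code (to_tree (if b x then f x else g x)) @ r))"
      using runs_mono[OF runs_Seq[OF runs_drop_tree computesD(3)[OF c]]]
        runs_mono[OF runs_Seq[OF runs_drop_tree computesD(3)[OF d]]] by (simp add: node)
    from runs_Cond_main[OF this]
    show "runs ?c (st a (code (to_tree x) @ r)) (?b (esize x))
        (st a (code (to_tree (if b x then f x else g x)) @ r))"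
      by (intro runs_mono[OF runs_Seq[OF runs_dup_tree runs_Seq[OF computesD(3)[OF c0]]]]) (use le in auto)
  qed
qed

lemma polytime_case_list:
  assumes "polytime l" "polytime f" "polytime (\<lambda>z. g (fst z) (fst (snd z)) (snd (snd z)))"
  shows "polytime (\<lambda>x. case l x of [] \<Rightarrow> f x | y # ys \<Rightarrow> g x y ys)"
proof -
  obtain c0 p0 c p d q where c0: "computes c0 l (poly p0)" and c: "computes c f (poly p)"
    and d: "computes d (\<lambda>z. g (fst z) (fst (snd z)) (snd (snd z))) (poly q)"
    using assms by (auto simp: polytime_def)
  let ?q = "\<lambda>n. poly q (1 + n + poly p0 n)"
  let ?b = "\<lambda>n. 100 + 100 * n + 100 * poly p0 n + 100 * poly p n + 100 * ?q n"
  \<comment> \<open>A list \<open>y # ys\<close> already has the code of the pair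
    \<open>(y, ys)\<close>, so bringing \<open>x\<close> above it and adding a node symbol yields
    the triple \<open>(x, y, ys)\<close>.\<close>
  let ?c = "Seq dup_tree (Seq c0 (Cond (\<lambda>as. as ! 1 = Aux 0)
    (Seq swap_trees (Seq (push_main (Aux 0)) d)) (Seq drop_tree c)))"
  let ?h = "\<lambda>x. case l x of [] \<Rightarrow> f x | y # ys \<Rightarrow> g x y ys"
  show ?thesis
  proof (rule polytimeI)
    show "prog_wf 5 syms ?c" using computesD(1)[OF c] computesD(1)[OF d] computesD(1)[OF c0] by simp
    show "poly_bounded ?b" by (intro poly_bounded_intros)
    fix x a r
    have le: "esize (f x) \<le> poly p (esize x)" "esize (l x) \<le> poly p0 (esize x)"
      using computesD(2)[OF c] computesD(2)[OF c0] by auto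
    have leq: "poly q (esize (x, y, ys)) \<le> ?q (esize x)" if "l x = y # ys" for y ys
      using le(2) by (intro poly_nat_mono) (auto simp: that)
    show "esize (?h x) \<le> ?b (esize x)"
    proof (cases "l x")
      case (Cons y ys)
      then show ?thesis using computesD(2)[OF d, of "(x, y, ys)"] leq[OF Cons] by simp
    qed (use le in simp)
    have "runs (if is_node (to_tree (l x)) then Seq swap_trees (Seq (push_main (Aux 0)) d) else Seq drop_tree c)
       (st a (code (to_tree (l x)) @ code (to_tree x) @ r))
       (50 + 50 * esize x + 50 * poly p0 (esize x) + poly p (esize x) + ?q (esize x))
       (st a (code (to_tree (?h x)) @ r))"
    proof (cases "l x")
      case Nil
      then show ?thesis using runs_mono[OF runs_Seq[OF runs_drop_tree[of a TNil] computesD(3)[OF c]]] le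
        by simp
    next
      case (Cons y ys)
      have t: "code (to_tree (x, y, ys)) @ r = Aux 0 # code (to_tree x) @ code (to_tree (l x)) @ r"
        by (simp add: Cons)
      have 1: "runs d (st a (Aux 0 # code (to_tree x) @ code (to_tree (l x)) @ r)) (?q (esize x))
        (st a (code (to_tree (?h x)) @ r))"
        using runs_mono[OF computesD(3)[OF d, of a "(x, y, ys)" r] leq[OF Cons]]
        unfolding t by (simp add: Cons)
      have "runs (Seq swap_trees (Seq (push_main (Aux 0)) d)) (st a (code (to_tree (l x)) @ code (to_tree x) @ r))
        (50 + 50 * esize x + 50 * poly p0 (esize x) + poly p (esize x) + ?q (esize x))
        (st a (code (to_tree (?h x)) @ r))"
        by (rule runs_mono[OF runs_Seq[OF runs_swap_trees runs_Seq[OF runs_push_main 1]]]) (use le in auto)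
      then show ?thesis by (simp add: Cons)
    qed
    from runs_Cond_main[OF this]
    show "runs ?c (st a (code (to_tree x) @ r)) (?b (esize x)) (st a (code (to_tree (?h x)) @ r))"
      by (intro runs_mono[OF runs_Seq[OF runs_dup_tree runs_Seq[OF computesD(3)[OF c0]]]]) (use le in auto)
  qed
qed

lemma eq_loop_wf [simp]: "prog_wf 5 syms eq_loop"
  by (auto simp: eq_loop_def intro!: pop_wf)

lemma polytime_eq': "polytime (\<lambda>p. fst p = snd p)"
proof (rule polytimeI)
  let ?t = "Cond (\<lambda>as. as ! 2 = Blank \<and> as ! 3 = Blank)
    (Seq (push_main (Aux (Suc 0))) (Seq (push_main (Aux (Suc 0))) (push_main (Aux 0))))
    (push_main (Aux (Suc 0)))"
  let ?c = "Seq pop_main (Seq (mv_tree 2) (Seq (mv_tree 3) (Seq eq_loop (Seq ?t (Seq (clear 2) (clear 3))))))"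
  show "prog_wf 5 syms ?c" by (simp add: mv_tree_wf clear_wf)
  show "poly_bounded (\<lambda>n. 100 + 100 * n)" by (intro poly_bounded_intros)
  fix x :: "'a \<times> 'a" and a r
  have "1 \<le> esize x" by (rule tsize_pos)
  then show "esize (fst x = snd x) \<le> 100 + 100 * esize x" by (auto simp: to_tree_bool_def)
  obtain y z where x: "x = (y, z)" by (cases x)
  let ?y = "code (to_tree y)" and ?z = "code (to_tree z)"
  have 1: "runs (mv_tree 2) (st a (?y @ ?z @ r)) (5 + 11 * esize y) [a, ?z @ r, rev ?y, [], []]"
    using runs_mv_tree[of 2 "st a (?y @ ?z @ r)" "to_tree y" "?z @ r"] by (simp add: numeral_eq_Suc)
  have 2: "runs (mv_tree 3) [a, ?z @ r, rev ?y, [], []] (5 + 11 * esize z) [a, r, rev ?y, rev ?z, []]"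
    using runs_mv_tree[of 3 "[a, ?z @ r, rev ?y, [], []]" "to_tree z" r] by (simp add: numeral_eq_Suc)
  obtain xs ys where 3: "runs eq_loop [a, r, rev ?y, rev ?z, []] (1 + 4 * esize y) [a, r, xs, ys, []]"
    and len: "length xs \<le> esize y" "length ys \<le> esize z" and iff: "xs = [] \<and> ys = [] \<longleftrightarrow> y = z"
    using runs_eq_loop[of "rev ?y" a r "rev ?z"] by (auto simp: code_not_Blank code_inject to_tree_inject)
  have 4: "runs ?t [a, r, xs, ys, []] 12 [a, code (to_tree (y = z)) @ r, xs, ys, []]"
  proof (rule runs_no_Blank)
    assume nb: "\<And>i. i < 5 \<Longrightarrow> Blank \<notin> set ([a, r, xs, ys, []] ! i)"
    have nb: "Blank \<notin> set xs" "Blank \<notin> set ys" using nb[of 2] nb[of 3] by (auto simp: numeral_eq_Suc)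
    have push: "runs (push_main s) [a, m, xs, ys, []] 3 [a, s # m, xs, ys, []]" if "s \<noteq> Blank" for s m
      using runs_push[of 1 "\<lambda>_. s" "[a, m, xs, ys, []]" s] that by simp
    have "runs (if y = z then Seq (push_main (Aux (Suc 0))) (Seq (push_main (Aux (Suc 0))) (push_main (Aux 0)))
        else push_main (Aux (Suc 0))) [a, r, xs, ys, []] 11 [a, code (to_tree (y = z)) @ r, xs, ys, []]"
      using runs_Seq[OF push[of "Aux (Suc 0)"] runs_Seq[OF push[of "Aux (Suc 0)"] push[of "Aux 0"]]]
        runs_mono[OF push[of "Aux (Suc 0)"]]
      by (simp add: to_tree_bool_def)
    moreover have "stack_top xs = Blank \<and> stack_top ys = Blank \<longleftrightarrow> y = z"
      using nb iff by (simp add: stack_top_Blank)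
    ultimately show "runs ?t [a, r, xs, ys, []] 12 [a, code (to_tree (y = z)) @ r, xs, ys, []]"
      by (intro runs_mono[OF runs_Cond[where n = 11]]) (auto simp: numeral_eq_Suc)
  qed
  have 5: "runs (clear 2) [a, m, xs, ys, []] (1 + 2 * length xs) [a, m, [], ys, []]" for m
    using runs_clear[of 2 "[a, m, xs, ys, []]"] by (simp add: numeral_eq_Suc)
  have 6: "runs (clear 3) [a, m, [], ys, []] (1 + 2 * length ys) (st a m)" for m
    using runs_clear[of 3 "[a, m, [], ys, []]"] by (simp add: numeral_eq_Suc)
  show "runs ?c (st a (code (to_tree x) @ r)) (100 + 100 * esize x) (st a (code (to_tree (fst x = snd x)) @ r))"
    unfolding x fst_conv snd_conv to_tree_Pair code.simps append.simps append_assoc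
    by (rule runs_mono[OF runs_Seq[OF runs_pop_main runs_Seq[OF 1 runs_Seq[OF 2 runs_Seq[OF 3
            runs_Seq[OF 4 runs_Seq[OF 5 6]]]]]]]) (use len in simp)
qed

text \<open>A nonempty list has the same code as the pair of its head and tail, so there is nothing
  to compute.\<close>

lemma polytime_Cons': "polytime (\<lambda>p. fst p # snd p)"
proof (rule polytimeI)
  show "prog_wf 5 syms (Seq (push_main (Aux 0)) pop_main)" by simp
  show "poly_bounded (\<lambda>n. n + 5)" by (intro poly_bounded_intros)
  fix x :: "'a \<times> 'a list" and a r
  have eq: "to_tree (fst x # snd x) = to_tree x" by (cases x) simp
  show "runs (Seq (push_main (Aux 0)) pop_main) (st a (code (to_tree x) @ r)) (esize x + 5)
    (st a (code (to_tree (fst x # snd x)) @ r))"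
    unfolding eq by (rule runs_mono[OF runs_Seq[OF runs_push_main runs_pop_main]]) auto
  show "esize (fst x # snd x) \<le> esize x + 5" unfolding eq by simp
qed

text \<open>Iterating a polynomial-time function may double the data in every round, so the number
  of rounds and the size of every intermediate state are assumed to be polynomial, though only for
  the states reached from \<open>init x\<close>.\<close>

lemma polytime_while:
  fixes init :: "'a::tree_enc \<Rightarrow> 's::tree_enc" and f :: "'s \<Rightarrow> 's"
  assumes "polytime init" "polytime b" "polytime f"
    and bound: "\<And>x. \<exists>k\<le>poly q (esize x). (\<forall>i<k. b ((f ^^ i) (init x))) \<and> \<not> b ((f ^^ k) (init x)) \<and>
      (\<forall>i\<le>k. esize ((f ^^ i) (init x)) \<le> poly q (esize x)) \<and> g x = (f ^^ k) (init x)"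
  shows "polytime g"
proof -
  obtain ci pi cb pb cf pf where ci: "computes ci init (poly pi)" and cb: "computes cb b (poly pb)"
    and cf: "computes cf f (poly pf)"
    using assms by (auto simp: polytime_def)
  let ?test = "Seq dup_tree cb"
  let ?body = "Seq drop_tree (Seq cf ?test)"
  let ?loop = "Loop (\<lambda>as. as ! 1 = Aux 0) ?body"
  let ?c = "Seq ci (Seq ?test (Seq ?loop drop_tree))"
  \<comment> \<open>\<open>W\<close> bounds one round: dropping the old test value, applying
    \<open>f\<close>, and testing the new state.\<close>
  define W where "W = (\<lambda>n. 100 + 100 * poly pb (poly q n) + 100 * poly q n + 100 * poly pf (poly q n))"
  let ?B = "\<lambda>n. 100 + 100 * poly pi n + poly q n * W n + W n"
  have W: "poly_bounded W" unfolding W_def by (intro poly_bounded_intros)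
  show ?thesis
  proof (rule polytimeI)
    show "prog_wf 5 syms ?c" using computesD(1)[OF ci] computesD(1)[OF cb] computesD(1)[OF cf] by simp
    show "poly_bounded ?B" by (intro poly_bounded_intros W)
    fix x a r
    obtain k where k: "k \<le> poly q (esize x)" "\<And>i. i < k \<Longrightarrow> b ((f ^^ i) (init x))" "\<not> b ((f ^^ k) (init x))"
      "\<And>i. i \<le> k \<Longrightarrow> esize ((f ^^ i) (init x)) \<le> poly q (esize x)" "g x = (f ^^ k) (init x)"
      using bound[of x] by blast
    define y where "y i = (f ^^ i) (init x)" for i
    have y: "esize (y i) \<le> poly q (esize x)" if "i \<le> k" for i
      using k(4)[OF that] by (simp add: y_def)
    have ySuc: "f (y i) = y (Suc i)" for i by (simp add: y_def)
    show "esize (g x) \<le> ?B (esize x)" using y[of k] by (simp add: k(5) y_def[symmetric] W_def)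
    let ?S = "\<lambda>i. st a (code (to_tree (b (y i))) @ code (to_tree (y i)) @ r)"
    let ?W = "W (esize x)"
    have test: "runs ?test (st a (code (to_tree (y i)) @ r))
        (12 + 33 * poly q (esize x) + poly pb (poly q (esize x))) (?S i)" if "i \<le> k" for i
      by (rule runs_mono[OF runs_Seq[OF runs_dup_tree computesD(3)[OF cb]]])
        (use y[OF that] poly_nat_mono[OF y[OF that], of pb] in simp)
    have sb: "esize (b (y i)) \<le> poly pb (poly q (esize x))" if "i \<le> k" for i
      using computesD(2)[OF cb, of "y i"] poly_nat_mono[OF y[OF that], of pb] by simp
    have body: "runs ?body (?S i) (?W - 1) (?S (Suc i))" if "i < k" for i
    proof -
      have 1: "runs cf (st a (code (to_tree (y i)) @ r)) (poly pf (poly q (esize x)))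
          (st a (code (to_tree (y (Suc i))) @ r))"
        unfolding ySuc[symmetric]
        by (rule runs_mono[OF computesD(3)[OF cf]]) (use that y[of i] in \<open>simp add: poly_nat_mono\<close>)
      show ?thesis
        by (rule runs_mono[OF runs_Seq[OF runs_drop_tree runs_Seq[OF 1 test]]])
          (use that sb[of i] in \<open>auto simp: W_def\<close>)
    qed
    have W1: "1 \<le> ?W" by (simp add: W_def)
    have top: "map stack_top (?S i) ! 1 = Aux 0 \<longleftrightarrow> b (y i)" for i
      by (simp add: stack_top_code) (simp add: to_tree_bool_def)
    \<comment> \<open>Induction on the number \<open>d\<close> of rounds still to go, counted back
      from the last state.\<close>
    have loop: "runs ?loop (?S (k - d)) (1 + d * ?W) (?S k)" if "d \<le> k" for d
      using that
    proof (induction d)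
      case 0
      have "\<not> map stack_top (?S k) ! 1 = Aux 0" unfolding top using k(3) by (simp add: y_def)
      from runs_Loop_stop[where b = "\<lambda>as. as ! 1 = Aux 0", OF this] show ?case by simp
    next
      case (Suc d)
      let ?i = "k - Suc d"
      have i: "?i < k" "Suc ?i = k - d" using Suc.prems by auto
      have "map stack_top (?S ?i) ! 1 = Aux 0" unfolding top using k(2)[OF i(1)] by (simp add: y_def)
      from runs_Loop_step[where b = "\<lambda>as. as ! 1 = Aux 0", OF this body[OF i(1), unfolded i(2)]
          Suc.IH[OF Suc_leD[OF Suc.prems]]]
      show ?case by (rule runs_mono) (use W1 in auto)
    qed
    have loop': "runs ?loop (?S 0) (1 + poly q (esize x) * ?W) (?S k)"
      using loop[of k] k(1) by (auto elim!: runs_mono)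
    have init: "runs ci (st a (code (to_tree x) @ r)) (poly pi (esize x)) (st a (code (to_tree (y 0)) @ r))"
      using computesD(3)[OF ci] by (simp add: y_def)
    show "runs ?c (st a (code (to_tree x) @ r)) (?B (esize x)) (st a (code (to_tree (g x)) @ r))"
      unfolding k(5) y_def[symmetric]
      by (rule runs_mono[OF runs_Seq[OF init runs_Seq[OF test runs_Seq[OF loop' runs_drop_tree]]]])
        (use sb[of k] in \<open>auto simp: W_def\<close>)
  qed
qed

lemma polytime_fst: "polytime f \<Longrightarrow> polytime (\<lambda>x. fst (f x))"
  by (rule polytime_comp[OF polytime_fst'])

lemma polytime_snd: "polytime f \<Longrightarrow> polytime (\<lambda>x. snd (f x))"
  by (rule polytime_comp[OF polytime_snd'])

lemma polytime_eq: "polytime f \<Longrightarrow> polytime g \<Longrightarrow> polytime (\<lambda>x. f x = g x)"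
  using polytime_comp[OF polytime_eq' polytime_Pair, of f g] by simp

lemma polytime_Cons: "polytime f \<Longrightarrow> polytime g \<Longrightarrow> polytime (\<lambda>x. f x # g x)"
  using polytime_comp[OF polytime_Cons' polytime_Pair, of f g] by simp

lemmas polytime_intros = polytime_id polytime_const polytime_fst polytime_snd polytime_Pair polytime_eq
  polytime_Cons polytime_If polytime_case_list

text \<open>This is a while loop over triples of parameter, unread list and accumulator; the
  parameter travels along because the step function may use it. The accumulator is bounded on the
  prefixes of \<open>l x\<close> only, since these give the states that the loop visits.\<close>

lemma polytime_foldl:
  assumes i: "polytime i" and l: "polytime l"
    and f: "polytime (\<lambda>z. f (fst z) (fst (snd z)) (snd (snd z)))"
    and bound: "\<And>x k. k \<le> length (l x) \<Longrightarrow> esize (foldl (f x) (i x) (take k (l x))) \<le> poly q (esize x)"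
  shows "polytime (\<lambda>x. foldl (f x) (i x) (l x))"
proof -
  define step where "step = (\<lambda>s. case fst (snd s) of [] \<Rightarrow> s
     | y # ys \<Rightarrow> (fst s, ys, f (fst s) (snd (snd s)) y))"
  have f': "polytime (\<lambda>x. f (a x) (b x) (c x))" if "polytime a" "polytime b" "polytime c"
    for a :: "'s::tree_enc \<Rightarrow> _" and b c
    using polytime_comp[OF f, of "\<lambda>x. (a x, b x, c x)"] that by (simp add: polytime_Pair)
  have step: "polytime step" unfolding step_def
    by (intro polytime_intros f')
  have iter: "(step ^^ k) (x, l x, i x) = (x, drop k (l x), foldl (f x) (i x) (take k (l x)))"
    if "k \<le> length (l x)" for x k
    using that
  proof (induction k)
    case (Suc k)
    then have "drop k (l x) = l x ! k # drop (Suc k) (l x)" by (simp add: Cons_nth_drop_Suc)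
    with Suc show ?case by (simp add: step_def take_Suc_conv_app_nth)
  qed simp
  obtain pl where pl: "\<And>x. esize (l x) \<le> poly pl (esize x)"
    using l computesD(2) by (metis polytime_def)
  have list: "length xs \<le> esize xs" for xs :: "'z::tree_enc list"
    by (induction xs) auto
  have drop: "esize (drop k xs) \<le> esize xs" for k and xs :: "'z::tree_enc list"
  proof (induction xs arbitrary: k)
    case (Cons x xs)
    show ?case using Cons[of "k - 1"] by (cases k) auto
  qed simp
  \<comment> \<open>The loop returns its whole final state, whose list is empty; the accumulator is
    projected out afterwards. In the bound, the constant 2 counts the node symbols of the
    triple.\<close>
  have "polytime (\<lambda>x. (x, [] :: 'c list, foldl (f x) (i x) (l x)))"
  proof (rule polytime_while[where init = "\<lambda>x. (x, l x, i x)" and f = step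
        and b = "\<lambda>s. if fst (snd s) = [] then False else True" and q = "[:2, 1:] + pl + q"])
    show "polytime (\<lambda>x. (x, l x, i x))" by (intro polytime_intros i l)
    show "polytime (\<lambda>s :: 'a \<times> 'c list \<times> 'b. if fst (snd s) = [] then False else True)"
      by (intro polytime_intros)
    fix x
    have "esize ((step ^^ k) (x, l x, i x)) \<le> poly ([:2, 1:] + pl + q) (esize x)" if "k \<le> length (l x)" for k
      using bound[OF that] drop[of k "l x"] pl[of x] by (simp add: iter[OF that])
    moreover have "length (l x) \<le> poly ([:2, 1:] + pl + q) (esize x)"
      using list[of "l x"] pl[of x] by simp
    ultimately show "\<exists>k\<le>poly ([:2, 1:] + pl + q) (esize x).
         (\<forall>j<k. if fst (snd ((step ^^ j) (x, l x, i x))) = [] then False else True) \<and>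
         \<not> (if fst (snd ((step ^^ k) (x, l x, i x))) = [] then False else True) \<and>
         (\<forall>j\<le>k. esize ((step ^^ j) (x, l x, i x)) \<le> poly ([:2, 1:] + pl + q) (esize x)) \<and>
         (x, [] :: 'c list, foldl (f x) (i x) (l x)) = (step ^^ k) (x, l x, i x)"
      by (intro exI[of _ "length (l x)"]) (auto simp: iter)
  qed (rule step)
  then have "polytime (\<lambda>x. snd (snd (x, [] :: 'c list, foldl (f x) (i x) (l x))))"
    by (intro polytime_snd)
  then show ?thesis by simp
qed

section \<open>Polynomial-time decidability and list functions\<close>

text \<open>A token with the node symbol on top of it turns the code of a list below into that of
  the list with the token in front, so the input is consed on token by token.\<close>

definition load_input :: "token prog" where
  "load_input = Seq (push_main (Aux (Suc 0))) (Loop (\<lambda>as. as ! 0 \<noteq> Blank)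
     (Seq (push 1 (\<lambda>as. as ! 0)) (Seq (push_main (Aux 0)) (pop 0))))"

lemma load_input_wf: "prog_wf 5 syms load_input"
  by (auto simp: load_input_def intro!: push_wf pop_wf)

lemma runs_load_input: "runs load_input (st (map Inp w) []) (5 + 10 * length w) (st [] (code (to_tree (rev w))))"
proof -
  let ?body = "Seq (push 1 (\<lambda>as. as ! 0)) (Seq (push_main (Aux 0)) (pop 0))"
  let ?b = "\<lambda>as :: sym list. as ! 0 \<noteq> Blank"
  have "runs (Loop ?b ?body) (st (map Inp w) (code (to_tree v))) (1 + 10 * length w)
      (st [] (code (to_tree (rev w @ v))))" for v
  proof (induction w arbitrary: v)
    case Nil
    show ?case using runs_Loop_stop[where b = ?b] by simp
  next
    case (Cons t w)
    have 1: "runs (push 1 (\<lambda>as. as ! 0)) (st (map Inp (t # w)) (code (to_tree v))) 3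
        (st (map Inp (t # w)) (Inp t # code (to_tree v)))"
      using runs_push[of 1 "\<lambda>as. as ! 0" "st (map Inp (t # w)) (code (to_tree v))" "Inp t"] by simp
    have 2: "runs (push_main (Aux 0)) (st (map Inp (t # w)) (Inp t # code (to_tree v))) 3
        (st (map Inp (t # w)) (code (to_tree (t # v))))"
      using runs_push_main[of "Aux 0"] by (simp add: to_tree_token_def)
    have 3: "runs (pop 0) (st (map Inp (t # w)) (code (to_tree (t # v)))) 1
        (st (map Inp w) (code (to_tree (t # v))))"
      using runs_pop[of 0 "st (map Inp (t # w)) (code (to_tree (t # v)))"] by simp
    have "runs (Loop ?b ?body) (st (map Inp (t # w)) (code (to_tree v)))
      (1 + (1 + 3 + (1 + 3 + 1)) + (1 + 10 * length w)) (st [] (code (to_tree (rev w @ t # v))))"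
      by (rule runs_Loop_step[where b = ?b, OF _ runs_Seq[OF 1 runs_Seq[OF 2 3]] Cons.IH[of "t # v"]]) simp
    then show ?case by (rule_tac runs_mono) auto
  qed
  from this[of "[]"]
  have "runs (Loop ?b ?body) (st (map Inp w) [Aux (Suc 0)]) (1 + 10 * length w) (st [] (code (to_tree (rev w))))"
    by simp
  from runs_Seq[OF runs_push_main this] show ?thesis
    unfolding load_input_def by simp
qed

text \<open>The head starts on the leftmost input cell; this is why the input tape is regarded as
  growing to the left, with its first token on top.\<close>

lemma stacks_init: "stacks (st (map Inp w) []) (input_tape w # replicate 4 empty_tape)"
proof -
  have "stack_tape (- 1) (map Inp w) (input_tape w)"
    by (auto simp: stack_tape_def input_tape_def)
  moreover have "stack_tape 1 [] empty_tape"
    by (auto simp: stack_tape_def empty_tape_def)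
  moreover have "i = 0 \<or> i = 1 \<or> i = 2 \<or> i = 3 \<or> i = 4" if "i < 5" for i :: nat
    using that by auto
  ultimately show ?thesis by (auto simp: stacks_def numeral_eq_Suc less_Suc_eq)
qed

lemma esize_token_list: "esize (w :: token list) = 2 * length w + 1"
  by (induction w) (auto simp: to_tree_token_def)

text \<open>Reading the input onto a stack reverses it.\<close>

theorem polytime_imp_poly_time_decidable:
  fixes f :: "token list \<Rightarrow> bool"
  assumes "polytime f" and f: "\<And>x. x \<in> I \<Longrightarrow> f (rev (enc x)) \<longleftrightarrow> P x"
  shows "poly_time_decidable I enc P"
proof -
  obtain c p where c: "computes c f (poly p)" using assms(1) by (auto simp: polytime_def)
  let ?c = "Seq load_input c"
  \<comment> \<open>\<open>2 * n + 1\<close> is the size of a list of \<open>n\<close> tokens, and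
    the outermost 1 provides the additional step that \<open>prog_tm\<close> asks for.\<close>
  define b where "b = (\<lambda>n. 1 + (1 + (5 + 10 * n) + poly p (2 * n + 1)))"
  have "poly_bounded b" unfolding b_def by (intro poly_bounded_intros)
  then obtain q where q: "\<And>n. b n \<le> poly q n" by (auto simp: poly_bounded_def)
  have wf: "prog_wf 5 syms ?c" using computesD(1)[OF c] load_input_wf by simp
  have "\<exists>M. wf_tm M \<and> (\<forall>w n ts N. exec ?c (input_tape w # replicate 4 empty_tape) n ts \<and> n < N \<longrightarrow>
      tm_state_after M w N = (if map tape_read ts ! 1 = Aux 0 then tm_accept M else tm_reject M))"
    using prog_tm[OF wf, of "\<lambda>as. as ! 1 = Aux 0"] finite_syms by (simp add: image_subset_iff)
  then obtain M where M: "wf_tm M"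
    "\<And>w n ts N. exec ?c (input_tape w # replicate 4 empty_tape) n ts \<Longrightarrow> n < N \<Longrightarrow>
      tm_state_after M w N = (if map tape_read ts ! 1 = Aux 0 then tm_accept M else tm_reject M)"
    by blast
  have "tm_state_after M w (poly q (length w)) = (if f (rev w) then tm_accept M else tm_reject M)" for w
  proof -
    have "runs c (st [] (code (to_tree (rev w)))) (poly p (2 * length w + 1)) (st [] (code (to_tree (f (rev w)))))"
      using computesD(3)[OF c, of "[]" "rev w" "[]"] by (simp add: esize_token_list)
    from runsE[OF runs_Seq[OF runs_load_input this] stacks_init]
    obtain m ts where m: "m \<le> 1 + (5 + 10 * length w) + poly p (2 * length w + 1)"
      and ex: "exec ?c (input_tape w # replicate 4 empty_tape) m ts"
      and ts: "stacks (st [] (code (to_tree (f (rev w))))) ts" .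
    have "m < poly q (length w)" using m q[of "length w"] by (simp add: b_def)
    moreover have "map tape_read ts ! 1 = Aux 0 \<longleftrightarrow> f (rev w)"
      using stack_top_code[of "to_tree (f (rev w))" "[]"] by (simp add: stacks_reads[OF ts]) (simp add: to_tree_bool_def)
    ultimately show ?thesis using M(2)[OF ex] by simp
  qed
  then show ?thesis unfolding poly_time_decidable_def using M(1) f
    by (intro exI[of _ M] exI[of _ q]) auto
qed

section \<open>List functions computable in polynomial time\<close>

lemma esize_append: "esize (xs @ ys) + 1 = esize xs + esize ys"
  by (induction xs) auto

lemma length_le_esize: "length xs \<le> esize xs"
  by (induction xs) auto

lemma esize_mem: "x \<in> set xs \<Longrightarrow> esize x \<le> esize xs"
  by (induction xs) auto

lemma polytime_bound:
  assumes "polytime f"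
  obtains p where "\<And>x. esize (f x) \<le> poly p (esize x)"
  using assms computesD(2) by (metis polytime_def)

lemma polytime_comp2:
  assumes "polytime (\<lambda>z. h (fst z) (snd z))" "polytime f" "polytime g"
  shows "polytime (\<lambda>x. h (f x) (g x))"
  using polytime_comp[OF assms(1) polytime_Pair[OF assms(2,3)]] by simp

text \<open>When the growth per step depends on the parameter and the element but not on the
  accumulator, the total growth is at most the number of elements times a fixed polynomial. Unlike
  the bound in \<open>polytime_foldl\<close>, this can be checked on a single step.\<close>

lemma polytime_foldl_additive:
  assumes i: "polytime i" and l: "polytime l"
    and f: "polytime (\<lambda>z. f (fst z) (fst (snd z)) (snd (snd z)))"
    and growth: "\<And>x acc y. esize (f x acc y) \<le> esize acc + poly q (esize x + esize y)"
  shows "polytime (\<lambda>x. foldl (f x) (i x) (l x))"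
proof -
  obtain pi where pi: "\<And>x. esize (i x) \<le> poly pi (esize x)" using polytime_bound[OF i] by blast
  obtain pl where pl: "\<And>x. esize (l x) \<le> poly pl (esize x)" using polytime_bound[OF l] by blast
  have bound: "esize (foldl (f x) a ys) \<le> esize a + length ys * poly q (esize x + n)"
    if "\<And>y. y \<in> set ys \<Longrightarrow> esize y \<le> n" for x a ys n
    using that
  proof (induction ys arbitrary: a)
    case (Cons y ys)
    have "poly q (esize x + esize y) \<le> poly q (esize x + n)"
      using Cons.prems[of y] by (intro poly_nat_mono) auto
    with Cons.IH[of "f x a y"] Cons.prems growth[of x a y] show ?case by fastforce
  qed simp
  show ?thesis
  proof (rule polytime_foldl[OF i l f, where q = "pi + pl * pcompose q ([:0, 1:] + pl)"])
    fix x k assume k: "k \<le> length (l x)"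
    have "esize y \<le> poly pl (esize x)" if "y \<in> set (take k (l x))" for y
      using esize_mem[OF in_set_takeD[OF that]] pl[of x] by simp
    from bound[of "take k (l x)" "poly pl (esize x)" x "i x", OF this]
    have "esize (foldl (f x) (i x) (take k (l x))) \<le>
      esize (i x) + k * poly q (esize x + poly pl (esize x))" using k by (simp add: min_absorb2)
    also have "\<dots> \<le> poly pi (esize x) + poly pl (esize x) * poly q (esize x + poly pl (esize x))"
      using pi[of x] pl[of x] k length_le_esize[of "l x"] by (intro add_mono mult_right_mono) auto
    finally show "esize (foldl (f x) (i x) (take k (l x))) \<le> poly (pi + pl * pcompose q ([:0, 1:] + pl)) (esize x)"
      by (simp add: poly_pcompose)
  qed
qed

lemma polytime_rev:
  assumes "polytime f"
  shows "polytime (\<lambda>x. rev (f x))"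
proof -
  have "polytime (\<lambda>x. foldl (\<lambda>acc y. y # acc) [] (f x))"
    \<comment> \<open>Putting \<open>y\<close> in front adds its code and one node symbol.\<close>
    by (rule polytime_foldl_additive[where q = "[:1, 1:]"]; (intro polytime_intros assms | simp))
  moreover have "foldl (\<lambda>acc y. y # acc) zs ys = rev ys @ zs" for zs ys :: "'b list"
    by (induction ys arbitrary: zs) auto
  ultimately show ?thesis by simp
qed

lemma polytime_foldr_additive:
  assumes i: "polytime i" and l: "polytime l"
    and f: "polytime (\<lambda>z. f (fst z) (snd (snd z)) (fst (snd z)))"
    and growth: "\<And>x acc y. esize (f x y acc) \<le> esize acc + poly q (esize x + esize y)"
  shows "polytime (\<lambda>x. foldr (f x) (l x) (i x))"
proof -
  have "polytime (\<lambda>x. foldl (\<lambda>acc y. f x y acc) (i x) (rev (l x)))"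
    using f by (intro polytime_foldl_additive[where q = q] i polytime_rev l growth)
  then show ?thesis by (simp add: foldr_conv_foldl)
qed

lemma polytime_append:
  assumes "polytime f" "polytime g"
  shows "polytime (\<lambda>x. f x @ g x)"
proof -
  have "polytime (\<lambda>x. foldr (\<lambda>y acc. y # acc) (f x) (g x))"
    by (rule polytime_foldr_additive[where q = "[:1, 1:]"]; (intro polytime_intros assms | simp))
  moreover have "foldr (\<lambda>y acc. y # acc) ys zs = ys @ zs" for zs ys :: "'b list"
    by (induction ys) auto
  ultimately show ?thesis by simp
qed

lemma polytime_concat_map:
  assumes f: "polytime (\<lambda>z. f (fst z) (snd z))" and l: "polytime l"
  shows "polytime (\<lambda>x. concat (map (f x) (l x)))"
proof -
  obtain p where p: "\<And>z. esize (f (fst z) (snd z)) \<le> poly p (esize z)" using polytime_bound[OF f] by blast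
  have "polytime (\<lambda>x. foldr (\<lambda>y acc. f x y @ acc) (l x) [])"
  proof (rule polytime_foldr_additive[where q = "pcompose p [:1, 1:]"])
    fix x acc y
    show "esize (f x y @ acc) \<le> esize acc + poly (pcompose p [:1, 1:]) (esize x + esize y)"
      using p[of "(x, y)"] esize_append[of "f x y" acc] by (simp add: poly_pcompose)
  qed (intro polytime_intros polytime_append polytime_comp2[OF f] l)+
  moreover have "foldr (\<lambda>y acc. h y @ acc) ys [] = concat (map h ys)" for ys and h :: "'b \<Rightarrow> 'c list"
    by (induction ys) auto
  ultimately show ?thesis by simp
qed

lemma polytime_Not:
  assumes "polytime f"
  shows "polytime (\<lambda>x. \<not> f x)"
proof -
  have "(\<lambda>x. \<not> f x) = (\<lambda>x. if f x then False else True)" by auto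
  then show ?thesis using assms by (simp only:) (intro polytime_intros)
qed

lemma polytime_conj:
  assumes "polytime f" "polytime g"
  shows "polytime (\<lambda>x. f x \<and> g x)"
proof -
  have "(\<lambda>x. f x \<and> g x) = (\<lambda>x. if f x then g x else False)" by auto
  then show ?thesis using assms by (simp only:) (intro polytime_intros)
qed

lemma polytime_disj:
  assumes "polytime f" "polytime g"
  shows "polytime (\<lambda>x. f x \<or> g x)"
proof -
  have "(\<lambda>x. f x \<or> g x) = (\<lambda>x. if f x then True else g x)" by auto
  then show ?thesis using assms by (simp only:) (intro polytime_intros)
qed

lemma polytime_Bex:
  assumes f: "polytime (\<lambda>z. f (fst z) (snd z))" and l: "polytime l"
  shows "polytime (\<lambda>x. \<exists>y\<in>set (l x). f x y)"
proof -
  have "polytime (\<lambda>x. \<not> concat (map (\<lambda>y. if f x y then [True] else []) (l x)) = [])"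
    by (intro polytime_Not polytime_intros polytime_concat_map f l)
  moreover have "(\<exists>y\<in>set ys. h y) \<longleftrightarrow> \<not> concat (map (\<lambda>y. if h y then [True] else []) ys) = []" for h and ys :: "'b list"
    by (induction ys) auto
  ultimately show ?thesis by simp
qed

lemma polytime_member:
  assumes "polytime f" "polytime l"
  shows "polytime (\<lambda>x. f x \<in> set (l x))"
proof -
  have "polytime (\<lambda>x. \<exists>y\<in>set (l x). f x = y)"
    by (intro polytime_Bex polytime_eq polytime_comp[OF assms(1)] polytime_intros assms)
  then show ?thesis by simp
qed

lemma polytime_remdups:
  assumes "polytime f"
  shows "polytime (\<lambda>x. remdups (f x))"
proof -
  have "polytime (\<lambda>x. foldr (\<lambda>y acc. if y \<in> set acc then acc else y # acc) (f x) [])"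
    by (rule polytime_foldr_additive[where q = "[:1, 1:]"]; (intro polytime_intros polytime_member assms | simp))
  moreover have "foldr (\<lambda>y acc. if y \<in> set acc then acc else y # acc) ys [] = remdups ys" for ys :: "'b list"
  proof -
    have "foldr (\<lambda>y acc. if y \<in> set acc then acc else y # acc) ys [] = remdups ys \<and> set (remdups ys) = set ys"
      by (induction ys) auto
    then show ?thesis ..
  qed
  ultimately show ?thesis by simp
qed

section \<open>Saturation of facts\<close>

primrec field :: "nat \<Rightarrow> 'a list list \<Rightarrow> 'a list" where
  "field 0 l = (case l of [] \<Rightarrow> [] | y # _ \<Rightarrow> y)"
| "field (Suc i) l = field i (case l of [] \<Rightarrow> [] | _ # ys \<Rightarrow> ys)"

definition split_at :: "'a \<Rightarrow> 'a list \<Rightarrow> 'a list list" where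
  "split_at c w = foldr (\<lambda>t acc. if t = c then [] # acc
     else (case acc of [] \<Rightarrow> [[t]] | h # r \<Rightarrow> (t # h) # r)) w [[]]"

definition head_token :: "token list \<Rightarrow> token" where
  "head_token z = (case z of [] \<Rightarrow> Bit False | t # _ \<Rightarrow> t)"

text \<open>In a fact \<open>(p, q, x, a, b)\<close>, the word \<open>x\<close> is an encoded stack operation or \<open>[Hash]\<close>, which stands
  for unmatched pushes. A sign is the first token of an encoded integer: \<open>Minus\<close>, \<open>Bit False\<close> (zero)
  or \<open>Bit True\<close>.\<close>

type_synonym fact = "token list \<times> token list \<times> token list \<times> token \<times> token"

definition parse_fact :: "token list list \<Rightarrow> fact" where
  "parse_fact p = (field 0 p, field 1 p, field 3 p, head_token (field 2 p), head_token (field 2 p))"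

text \<open>Field 5 of the encoding lists the transitions. Each ends in a semicolon, so splitting
  leaves an empty last piece, which has to be dropped.\<close>

definition parse_facts :: "token list \<Rightarrow> fact list" where
  "parse_facts w = concat (map (\<lambda>p. if p = [] then [] else [parse_fact (split_at Comma p)])
     (split_at Semicolon (field 5 (split_at Hash w))))"

text \<open>Only compositions that a normal form of paths requires are formed. A push keeps its
  symbol until the matching pop cancels it. Pushes composed with each other become anonymous and can
  never be popped, so this composition serves for symbols that remain on the stack for good.\<close>

definition op_comp :: "token list \<Rightarrow> token list \<Rightarrow> token list list" where
  "op_comp x y =
     (if x = [] then [y] else if y = [] then [x]
      else if head_token x = PopMark \<or> head_token y = PopMark \<and> head_token x \<noteq> PushMark then []
      else if head_token y = PopMark then (if tl x = tl y then [[]] else [])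
      else [[Hash]])"

text \<open>An associative operation with unit \<open>Bit False\<close>. It accumulates the first
  nonzero sign of a path and, with the operands exchanged, the last one.\<close>

definition nonzero_or :: "token \<Rightarrow> token \<Rightarrow> token" where
  "nonzero_or a b = (if a = Bit False then b else a)"

definition fact_comp :: "fact \<Rightarrow> fact \<Rightarrow> fact list" where
  "fact_comp f g =
     (if fst (snd f) = fst g then map (\<lambda>x. (fst f, fst (snd g), x,
         nonzero_or (fst (snd (snd (snd f)))) (fst (snd (snd (snd g)))),
         nonzero_or (snd (snd (snd (snd g)))) (snd (snd (snd (snd f))))))
       (op_comp (fst (snd (snd f))) (fst (snd (snd g))))
      else [])"

definition saturation_step :: "fact list \<Rightarrow> fact list" where
  "saturation_step L = remdups (concat (map (\<lambda>f. concat (map (\<lambda>g. fact_comp f g) L)) L) @ L)"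

definition lists_mult :: "'a list \<Rightarrow> 'b list \<Rightarrow> 'b list" where
  "lists_mult xs ys = concat (map (\<lambda>_. ys) xs)"

text \<open>A clock, of which only the length \<open>(length T + 2) ^ 5\<close> matters: five
  factors for the five components of a fact, and 2 for the effects \<open>[]\<close> and
  \<open>[Hash]\<close>, which may arise beyond those in \<open>T\<close>.\<close>

definition counter :: "fact list \<Rightarrow> fact list" where
  "counter T = (let W = ([], [], [], Hash, Hash) # ([], [], [], Hash, Hash) # T in
     lists_mult W (lists_mult W (lists_mult W (lists_mult W W))))"

definition saturate :: "fact list \<Rightarrow> fact list" where
  "saturate T = foldl (\<lambda>L _. saturation_step L) T (counter T)"

text \<open>The first disjunct covers the path without transitions, which no fact describes. Facts
  that pop are excluded because the initial stack consists of the bottom symbol, which is never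
  popped.\<close>

definition answer :: "(token \<times> token) list \<Rightarrow> token list \<Rightarrow> bool" where
  "answer ok w \<longleftrightarrow> field 0 (split_at Hash w) = field 1 (split_at Hash w) \<or>
     (\<exists>f \<in> set (saturate (parse_facts w)). fst f = field 0 (split_at Hash w) \<and>
        fst (snd f) = field 1 (split_at Hash w) \<and> head_token (fst (snd (snd f))) \<noteq> PopMark \<and>
        snd (snd (snd f)) \<in> set ok)"

section \<open>Polynomial running time of the saturation\<close>

lemma polytime_field: "polytime f \<Longrightarrow> polytime (\<lambda>x. field i (f x))"
proof (induction i arbitrary: f)
  case 0
  then show ?case unfolding field.simps by (intro polytime_intros)
next
  case (Suc i)
  have "polytime (\<lambda>x. case f x of [] \<Rightarrow> [] | y # ys \<Rightarrow> ys)"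
    by (intro polytime_intros Suc.prems)
  from Suc.IH[OF this] show ?case by simp
qed

lemma polytime_split_at:
  assumes "polytime f"
  shows "polytime (\<lambda>x. split_at c (f x))"
  unfolding split_at_def
  by (rule polytime_foldr_additive[where q = "[:5, 1:]"]; (intro polytime_intros assms)?)
    (auto split: list.split)

lemma polytime_head_token: "polytime f \<Longrightarrow> polytime (\<lambda>x. head_token (f x))"
  unfolding head_token_def by (intro polytime_intros)

lemma polytime_tl: "polytime f \<Longrightarrow> polytime (\<lambda>x. tl (f x))"
  unfolding list.sel tl_def by (intro polytime_intros)

lemma polytime_map:
  assumes "polytime (\<lambda>z. f (fst z) (snd z))" "polytime l"
  shows "polytime (\<lambda>x. map (f x) (l x))"
proof -
  have "polytime (\<lambda>x. concat (map (\<lambda>y. [f x y]) (l x)))"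
    by (intro polytime_concat_map polytime_intros assms)
  then show ?thesis by simp
qed

lemma polytime_parse_facts:
  assumes "polytime f"
  shows "polytime (\<lambda>x. parse_facts (f x))"
  unfolding parse_facts_def parse_fact_def
  by (intro polytime_concat_map polytime_intros polytime_split_at polytime_field polytime_head_token assms)

lemma polytime_op_comp:
  assumes "polytime f" "polytime g"
  shows "polytime (\<lambda>x. op_comp (f x) (g x))"
  unfolding op_comp_def
  by (intro polytime_intros polytime_head_token polytime_tl polytime_Not polytime_conj polytime_disj assms)

lemma polytime_nonzero_or:
  assumes "polytime f" "polytime g"
  shows "polytime (\<lambda>x. nonzero_or (f x) (g x))"
  unfolding nonzero_or_def by (intro polytime_intros assms)

lemma polytime_fact_comp:
  assumes "polytime f" "polytime g"
  shows "polytime (\<lambda>x. fact_comp (f x) (g x))"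
proof -
  have "polytime (\<lambda>z. fact_comp (fst z) (snd z))"
    unfolding fact_comp_def
    by (intro polytime_map polytime_intros polytime_op_comp polytime_nonzero_or)
  from polytime_comp2[OF this assms] show ?thesis .
qed

lemma polytime_saturation_step:
  assumes "polytime f"
  shows "polytime (\<lambda>x. saturation_step (f x))"
proof -
  have "polytime saturation_step"
    unfolding saturation_step_def
    by (intro polytime_remdups polytime_append polytime_concat_map polytime_fact_comp polytime_intros)
  from polytime_comp[OF this assms] show ?thesis .
qed

lemma polytime_lists_mult:
  assumes "polytime f" "polytime g"
  shows "polytime (\<lambda>x. lists_mult (f x) (g x))"
proof -
  have "polytime (\<lambda>z. lists_mult (fst z) (snd z))"
    unfolding lists_mult_def by (intro polytime_concat_map polytime_intros)
  from polytime_comp2[OF this assms] show ?thesis .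
qed

lemma length_lists_mult: "length (lists_mult xs ys) = length xs * length ys"
  by (induction xs) (auto simp: lists_mult_def)

lemma power5: "(n::nat) ^ 5 = n * (n * (n * (n * n)))"
  by (simp add: eval_nat_numeral)

lemma length_counter: "length (counter T) = (length T + 2) ^ 5"
proof -
  have "length (a # b # T) = length T + 2" for a b by simp
  then show ?thesis by (simp only: counter_def Let_def length_lists_mult power5)
qed

lemma polytime_counter:
  assumes "polytime f"
  shows "polytime (\<lambda>x. counter (f x))"
  unfolding counter_def Let_def by (intro polytime_lists_mult polytime_intros assms)

text \<open>A finite set closed under composition: a composite takes its states and signs from its
  two operands, and its effect is one of theirs or one of \<open>[]\<close> and
  \<open>[Hash]\<close>.\<close>

definition universe :: "fact list \<Rightarrow> fact set" where
  "universe T = fst ` set T \<times> (\<lambda>f. fst (snd f)) ` set T \<times>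
     insert [] (insert [Hash] ((\<lambda>f. fst (snd (snd f))) ` set T)) \<times>
     (\<lambda>f. fst (snd (snd (snd f)))) ` set T \<times> (\<lambda>f. snd (snd (snd (snd f)))) ` set T"

lemma finite_universe: "finite (universe T)"
  by (simp add: universe_def)

lemma card_universe: "card (universe T) \<le> (length T + 2) ^ 5"
proof -
  have 1: "card (h ` set T) \<le> length T + 2" for h :: "fact \<Rightarrow> 'b"
    using card_image_le[of "set T" h] card_length[of T] by simp
  have 2: "card (insert a (insert b (h ` set T))) \<le> length T + 2" for a b and h :: "fact \<Rightarrow> 'b"
    using card_insert_le_m1[of "length T + 2" "insert b (h ` set T)" a]
      card_insert_le_m1[of "length T + 1" "h ` set T" b] card_image_le[of "set T" h] card_length[of T]
    by simp
  have "card (universe T) \<le> (length T + 2) * ((length T + 2) * ((length T + 2) * ((length T + 2) * (length T + 2))))"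
    unfolding universe_def card_cartesian_product by (intro mult_le_mono 1 2)
  then show ?thesis unfolding power5 .
qed

lemma set_subset_universe: "set T \<subseteq> universe T"
proof
  fix f assume "f \<in> set T"
  then show "f \<in> universe T"
    unfolding universe_def mem_Times_iff by (intro conjI insertI2) (rule image_eqI[where x = f], rule refl, assumption)+
qed

lemma op_comp_mem: "set (op_comp x y) \<subseteq> {[], [Hash], x, y}"
  unfolding op_comp_def
  by (cases "x = []"; cases "y = []"; cases "head_token x = PopMark"; cases "head_token y = PopMark";
      cases "head_token x = PushMark"; cases "tl x = tl y") simp_all

lemma fact_comp_universe:
  assumes "f \<in> universe T" "g \<in> universe T"
  shows "set (fact_comp f g) \<subseteq> universe T"
proof
  fix h assume h: "h \<in> set (fact_comp f g)"
  obtain p q x a b where f: "f = (p, q, x, a, b)" by (cases f)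
  obtain p' q' x' a' b' where g: "g = (p', q', x', a', b')" by (cases g)
  from h obtain z where "h = (p, q', z, nonzero_or a a', nonzero_or b' b)" "z \<in> set (op_comp x x')"
    by (auto simp: fact_comp_def f g split: if_splits)
  with op_comp_mem[of x x'] assms show "h \<in> universe T"
    by (auto simp: universe_def f g nonzero_or_def)
qed

definition fact_closure_step :: "fact set \<Rightarrow> fact set" where
  "fact_closure_step S = (\<Union>f\<in>S. \<Union>g\<in>S. set (fact_comp f g)) \<union> S"

lemma set_saturation_step: "set (saturation_step L) = fact_closure_step (set L)"
  by (simp add: saturation_step_def fact_closure_step_def)

lemma foldl_const: "foldl (\<lambda>L _. h L) a xs = (h ^^ length xs) a"
  by (induction xs arbitrary: a) (auto simp: funpow_swap1)

lemma set_saturation_iter: "set ((saturation_step ^^ k) T) = (fact_closure_step ^^ k) (set T)"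
  by (induction k) (auto simp: set_saturation_step)

lemma saturation_iter_universe: "set ((saturation_step ^^ k) T) \<subseteq> universe T"
proof (induction k)
  case 0
  then show ?case by (simp add: set_subset_universe)
next
  case (Suc k)
  let ?L = "(saturation_step ^^ k) T"
  have "set (fact_comp f g) \<subseteq> universe T" if "f \<in> set ?L" "g \<in> set ?L" for f g
    using Suc that by (intro fact_comp_universe) auto
  then have "fact_closure_step (set ?L) \<subseteq> universe T"
    unfolding fact_closure_step_def using Suc by (intro Un_least UN_least)
  then show ?case by (simp add: set_saturation_step)
qed

lemma esize_fact_universe:
  assumes "f \<in> universe T"
  shows "esize f \<le> 3 * esize T + 20"
proof -
  obtain p q x a b where f: "f = (p, q, x, a, b)" by (cases f)
  have comp: "esize (fst g) \<le> esize T" "esize (fst (snd g)) \<le> esize T" "esize (fst (snd (snd g))) \<le> esize T + 3"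
    if "g \<in> set T" for g
    using esize_mem[OF that] by (cases g, simp)+
  have "esize p \<le> esize T" "esize q \<le> esize T" "esize x \<le> esize T + 3"
    using assms comp by (auto simp: universe_def f to_tree_token_def)
  moreover have "esize a = 1" "esize b = 1" by (auto simp: to_tree_token_def)
  ultimately show ?thesis by (simp add: f)
qed

lemma esize_list_le: "(\<And>x. x \<in> set xs \<Longrightarrow> esize x \<le> n) \<Longrightarrow> esize xs \<le> 1 + length xs * (n + 1)"
  by (induction xs) fastforce+

text \<open>After at least one round the list has no duplicates, so its length is bounded by the
  number of facts in the universe. Round 0 is separate because \<open>T\<close> itself may contain
  repetitions.\<close>

lemma esize_saturation_iter:
  "esize ((saturation_step ^^ k) T) \<le> poly (1 + [:2, 1:] ^ 5 * [:21, 3:]) (esize T)"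
proof -
  let ?L = "(saturation_step ^^ k) T"
  have "length ?L \<le> (esize T + 2) ^ 5"
  proof (cases k)
    case 0
    have "length T \<le> (esize T + 2) ^ 1" using length_le_esize[of T] by simp
    also have "\<dots> \<le> (esize T + 2) ^ 5" by (rule power_increasing) auto
    finally show ?thesis by (simp add: 0)
  next
    case (Suc k')
    then have "distinct ?L" by (simp add: saturation_step_def)
    then have "length ?L \<le> card (universe T)"
      using card_mono[OF finite_universe saturation_iter_universe[of k T]] by (simp add: distinct_card)
    also have "\<dots> \<le> (length T + 2) ^ 5" by (rule card_universe)
    also have "\<dots> \<le> (esize T + 2) ^ 5" using length_le_esize[of T] by (intro power_mono) auto
    finally show ?thesis .
  qed
  moreover have "esize ?L \<le> 1 + length ?L * (3 * esize T + 20 + 1)"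
    using saturation_iter_universe by (intro esize_list_le esize_fact_universe) blast
  ultimately have "esize ?L \<le> 1 + (esize T + 2) ^ 5 * (3 * esize T + 20 + 1)"
    by (meson add_left_mono le_trans mult_le_mono1)
  then show ?thesis by (simp add: algebra_simps)
qed

lemma polytime_saturate:
  assumes "polytime f"
  shows "polytime (\<lambda>x. saturate (f x))"
proof -
  have step: "polytime (\<lambda>z :: fact list \<times> fact list \<times> fact. saturation_step (fst (snd z)))"
    by (intro polytime_saturation_step polytime_intros)
  have "polytime saturate"
    unfolding saturate_def
  proof (rule polytime_foldl[OF polytime_id polytime_counter[OF polytime_id] step])
    fix T :: "fact list" and k
    show "esize (foldl (\<lambda>L _. saturation_step L) T (take k (counter T))) \<le>
      poly (1 + [:2, 1:] ^ 5 * [:21, 3:]) (esize T)"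
      unfolding foldl_const by (rule esize_saturation_iter)
  qed
  from polytime_comp[OF this assms] show ?thesis .
qed

text \<open>The reversal undoes the one that takes place when the input is read.\<close>

theorem polytime_answer: "polytime (\<lambda>w. answer ok (rev w))"
  unfolding answer_def
  by (intro polytime_disj polytime_Bex polytime_conj polytime_Not polytime_member polytime_intros
      polytime_field polytime_split_at polytime_saturate polytime_parse_facts polytime_head_token polytime_rev)

section \<open>The saturation as a least closed set\<close>

inductive_set fact_closure :: "fact set \<Rightarrow> fact set" for T where
  base: "f \<in> T \<Longrightarrow> f \<in> fact_closure T"
| comp: "f \<in> fact_closure T \<Longrightarrow> g \<in> fact_closure T \<Longrightarrow> h \<in> set (fact_comp f g) \<Longrightarrow> h \<in> fact_closure T"

text \<open>A stationary round stays stationary, so if round \<open>n\<close> still added something,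
  then so did every earlier one. This would give at least \<open>n + 1\<close> elements inside
  \<open>U\<close>.\<close>

lemma funpow_inflationary_fixpoint:
  fixes h :: "'a set \<Rightarrow> 'a set"
  assumes infl: "\<And>S. S \<subseteq> h S" and U: "finite U" "\<And>k. (h ^^ k) S \<subseteq> U" and n: "card U \<le> n"
  shows "h ((h ^^ n) S) = (h ^^ n) S"
proof (rule ccontr)
  assume neq: "h ((h ^^ n) S) \<noteq> (h ^^ n) S"
  have strict: "(h ^^ i) S \<subset> (h ^^ Suc i) S" if "i \<le> n" for i
  proof -
    have "h ((h ^^ i) S) \<noteq> (h ^^ i) S"
    proof
      assume eq: "h ((h ^^ i) S) = (h ^^ i) S"
      have "(h ^^ (j + i)) S = (h ^^ i) S" for j by (induction j) (auto simp: eq)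
      from this[of "n - i"] neq eq that show False by simp
    qed
    then show ?thesis using infl by auto
  qed
  have "i \<le> card ((h ^^ i) S)" if "i \<le> Suc n" for i
    using that
  proof (induction i)
    case (Suc i)
    have "finite ((h ^^ Suc i) S)" using U finite_subset by blast
    from psubset_card_mono[OF this strict[of i]] Suc show ?case by simp
  qed simp
  from this[of "Suc n"] card_mono[OF U(1) U(2)[of "Suc n"]] n show False by simp
qed

theorem set_saturate: "set (saturate T) = fact_closure (set T)"
proof -
  let ?n = "length (counter T)"
  let ?S = "(fact_closure_step ^^ ?n) (set T)"
  have sat: "set (saturate T) = ?S"
    by (simp add: saturate_def foldl_const set_saturation_iter)
  have fixed: "fact_closure_step ?S = ?S"
  proof (rule funpow_inflationary_fixpoint[OF _ finite_universe[of T]])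
    show "(fact_closure_step ^^ k) (set T) \<subseteq> universe T" for k
      using saturation_iter_universe[of k T] by (simp only: set_saturation_iter)
    show "card (universe T) \<le> ?n" unfolding length_counter by (rule card_universe)
  qed (auto simp: fact_closure_step_def)
  have mono: "set T \<subseteq> (fact_closure_step ^^ k) (set T)" for k
    by (induction k) (auto simp: fact_closure_step_def)
  have "f \<in> ?S" if "f \<in> fact_closure (set T)" for f
    using that
  proof induction
    case (base f)
    then show ?case using mono by blast
  next
    case (comp f g h)
    then have "h \<in> fact_closure_step ?S" unfolding fact_closure_step_def by blast
    then show ?case by (simp only: fixed)
  qed
  moreover have "(fact_closure_step ^^ k) (set T) \<subseteq> fact_closure (set T)" for k
    by (induction k) (auto simp: fact_closure_step_def intro: fact_closure.intros)
  ultimately show ?thesis using sat by blast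
qed

section \<open>Facts and signed paths\<close>

lemma enc_nat_induct [case_names small large]:
  fixes n :: nat
  assumes "\<And>n. n < 2 \<Longrightarrow> P n" "\<And>n. 2 \<le> n \<Longrightarrow> P (n div 2) \<Longrightarrow> P n"
  shows "P n"
proof (induction n rule: less_induct)
  case (less n)
  show ?case
  proof (cases "n < 2")
    case False
    then have "P (n div 2)" by (intro less.IH) simp
    then show ?thesis using False assms(2)[of n] by simp
  qed (rule assms(1))
qed

lemma enc_nat_small: "n < 2 \<Longrightarrow> enc_nat n = [Bit (n = 1)]"
  by (subst enc_nat.simps) simp

lemma enc_nat_large: "2 \<le> n \<Longrightarrow> enc_nat n = enc_nat (n div 2) @ [Bit (odd n)]"
  by (subst enc_nat.simps) simp

lemma set_enc_nat: "set (enc_nat n) \<subseteq> range Bit"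
  by (induction n rule: enc_nat_induct) (auto simp: enc_nat_small enc_nat_large)

lemma enc_nat_nonempty: "enc_nat n \<noteq> []"
  by (cases "n < 2") (auto simp: enc_nat_small enc_nat_large)

text \<open>The most significant bit comes first and there are no leading zeros, so the first bit
  alone tells zero from nonzero.\<close>

lemma head_token_enc_nat: "head_token (enc_nat n) = Bit (n \<noteq> 0)"
proof (induction n rule: enc_nat_induct)
  case (small n)
  then show ?case by (auto simp: enc_nat_small head_token_def)
next
  case (large n)
  have "head_token (xs @ ys) = head_token xs" if "xs \<noteq> []" for xs ys
    using that by (cases xs) (auto simp: head_token_def)
  with large enc_nat_nonempty show ?case by (auto simp: enc_nat_large)
qed

lemma enc_nat_inject: "enc_nat m = enc_nat n \<longleftrightarrow> m = n"
proof -
  \<comment> \<open>\<open>val\<close> evaluates a binary word and is a left inverse of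
    \<open>enc_nat\<close>.\<close>
  define val where "val w = foldl (\<lambda>k t. 2 * k + (if t = Bit True then 1 else 0)) (0::nat) w" for w
  have "val (enc_nat n) = n" for n
  proof (induction n rule: enc_nat_induct)
    case (small n)
    then show ?case by (auto simp: enc_nat_small val_def)
  next
    case (large n)
    then show ?case by (auto simp: enc_nat_large val_def)
  qed
  then show ?thesis by metis
qed

lemma split_at_Nil: "split_at c [] = [[]]"
  by (simp add: split_at_def)

lemma split_at_append: "c \<notin> set a \<Longrightarrow> split_at c (a @ c # b) = a # split_at c b"
  by (induction a) (auto simp: split_at_def)

lemma split_at_none: "c \<notin> set a \<Longrightarrow> split_at c a = [a]"
  by (induction a) (auto simp: split_at_def)

text \<open>Every nonempty piece ends in its only \<open>c\<close>, so the word is cut exactly at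
  the ends of the pieces; the empty word is what follows the last cut.\<close>

lemma set_split_at_concat:
  assumes "\<And>p. p \<in> set ps \<Longrightarrow> p = [] \<or> (\<exists>b. p = b @ [c] \<and> c \<notin> set b)"
  shows "set (split_at c (concat ps)) = insert [] {b. b @ [c] \<in> set ps}"
  using assms
proof (induction ps)
  case Nil
  then show ?case by (simp add: split_at_Nil)
next
  case (Cons p ps)
  have IH: "set (split_at c (concat ps)) = insert [] {b. b @ [c] \<in> set ps}"
    using Cons.IH Cons.prems by simp
  consider "p = []" | b where "p = b @ [c]" "c \<notin> set b"
    using Cons.prems[of p] by auto
  then show ?case by cases (auto simp: IH split_at_append)
qed

lemma concat_map_concat: "concat (map (\<lambda>s. concat (h s)) xs) = concat (concat (map h xs))"
  by (induction xs) auto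

definition sign_token :: "int \<Rightarrow> token" where
  "sign_token z = (if z < 0 then Minus else if z = 0 then Bit False else Bit True)"

definition trans_facts :: "(nat, nat) c1pvass \<Rightarrow> fact set" where
  "trans_facts A = {(enc_nat s, enc_nat t, enc_op oper, sign_token z, sign_token z) | s t z oper.
     trans A s t = Some (z, oper)}"

lemma head_token_enc_int: "head_token (enc_int z) = sign_token z"
  by (simp add: enc_int_def sign_token_def head_token_enc_nat)
    (simp add: head_token_def)

lemma tokens_not_in_enc:
  assumes "c \<in> {Hash, Comma, Semicolon}"
  shows "c \<notin> set (enc_nat n)" "c \<notin> set (enc_int z)" "c \<notin> set (enc_op oper)"
proof -
  show nat: "c \<notin> set (enc_nat n)" for n
    using set_enc_nat[of n] assms by auto
  show "c \<notin> set (enc_int z)" using nat assms by (auto simp: enc_int_def)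
  show "c \<notin> set (enc_op oper)" using nat assms by (cases oper) auto
qed

lemma set_parse_facts:
  assumes "zero_c1pvass A"
  shows "set (parse_facts (encode A)) = trans_facts A"
    and "field 0 (split_at Hash (encode A)) = enc_nat (init A)"
    and "field 1 (split_at Hash (encode A)) = enc_nat (final A)"
proof -
  let ?S = "sorted_list_of_set (states A)" and ?G = "sorted_list_of_set (stack_alphabet A)"
  have wf: "wf_c1pvass A" using assms by (simp add: zero_c1pvass_def)
  have S: "set ?S = states A" using wf by (simp add: wf_c1pvass_def)
  define T where "T = concat (map (\<lambda>s. concat (map (enc_trans A s) ?S)) ?S)"
  note notin = tokens_not_in_enc[of Hash, simplified] tokens_not_in_enc[of Comma, simplified]
    tokens_not_in_enc[of Semicolon, simplified]
  have T: "Hash \<notin> set T"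
    using notin by (auto simp: T_def enc_trans_def split: option.splits)
  have states: "Hash \<notin> set (concat (map (enc_state A) ?S))"
    using notin by (auto simp: enc_state_def)
  have alphabet: "Hash \<notin> set (concat (map (\<lambda>a. enc_nat a @ [Semicolon]) ?G))"
    using notin by auto
  have enc: "Hash \<notin> set (enc_nat n)" for n using notin by auto
  have split: "split_at Hash (encode A) = [enc_nat (init A), enc_nat (final A), enc_nat (bottom A),
      concat (map (enc_state A) ?S), concat (map (\<lambda>a. enc_nat a @ [Semicolon]) ?G), T]"
    unfolding encode_def Let_def T_def[symmetric] append.simps
    by (simp only: split_at_append[OF enc] split_at_append[OF states] split_at_append[OF alphabet]
        split_at_none[OF T])
  show "field 0 (split_at Hash (encode A)) = enc_nat (init A)"
    and "field 1 (split_at Hash (encode A)) = enc_nat (final A)"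
    by (simp_all add: split)
  have field: "field 5 (split_at Hash (encode A)) = T" by (simp add: split numeral_eq_Suc)
  define body where "body = (\<lambda>s t z oper. enc_nat s @ Comma # enc_nat t @ Comma # enc_int z @ Comma # enc_op oper)"
  have body: "enc_trans A s t = (case trans A s t of None \<Rightarrow> [] | Some (z, oper) \<Rightarrow> body s t z oper @ [Semicolon])"
    for s t by (simp add: enc_trans_def body_def split: option.split)
  have body_notin: "Semicolon \<notin> set (body s t z oper)" for s t z oper
    using notin by (auto simp: body_def)
  have parse: "parse_fact (split_at Comma (body s t z oper)) =
      (enc_nat s, enc_nat t, enc_op oper, sign_token z, sign_token z)" for s t z oper
  proof -
    have "split_at Comma (body s t z oper) = [enc_nat s, enc_nat t, enc_int z, enc_op oper]"
      unfolding body_def using notin by (simp add: split_at_append split_at_none image_iff)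
    then show ?thesis by (simp add: parse_fact_def head_token_enc_int numeral_eq_Suc)
  qed
  define ps where "ps = concat (map (\<lambda>s. map (enc_trans A s) ?S) ?S)"
  have T_ps: "T = concat ps" unfolding T_def ps_def by (rule concat_map_concat)
  have ps: "set ps = {enc_trans A s t | s t. s \<in> states A \<and> t \<in> states A}"
    using S by (auto simp: ps_def)
  have set_split: "set (split_at Semicolon T) = insert [] {b. b @ [Semicolon] \<in> set ps}"
    unfolding T_ps
  proof (rule set_split_at_concat)
    fix p assume "p \<in> set ps"
    then obtain s t where "p = enc_trans A s t" by (auto simp: ps)
    then show "p = [] \<or> (\<exists>b. p = b @ [Semicolon] \<and> Semicolon \<notin> set b)"
      using body_notin by (auto simp: body split: option.split)
  qed
  have mem: "b @ [Semicolon] \<in> set ps \<longleftrightarrow> (\<exists>s t z oper. trans A s t = Some (z, oper) \<and> b = body s t z oper)" for b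
  proof
    assume "b @ [Semicolon] \<in> set ps"
    then obtain s t where "b @ [Semicolon] = enc_trans A s t" by (auto simp: ps)
    then show "\<exists>s t z oper. trans A s t = Some (z, oper) \<and> b = body s t z oper"
      by (auto simp: body split: option.splits)
  next
    assume "\<exists>s t z oper. trans A s t = Some (z, oper) \<and> b = body s t z oper"
    then obtain s t z oper where b: "trans A s t = Some (z, oper)" "b = body s t z oper" by blast
    moreover have "s \<in> states A" "t \<in> states A" using wf b(1) by (auto simp: wf_c1pvass_def)
    moreover have "b @ [Semicolon] = enc_trans A s t" using b by (simp add: body)
    ultimately show "b @ [Semicolon] \<in> set ps" unfolding ps by blast
  qed
  define B where "B = {b. b @ [Semicolon] \<in> set ps}"
  have B: "B = {b. \<exists>s t z oper. trans A s t = Some (z, oper) \<and> b = body s t z oper}"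
    unfolding B_def mem ..
  \<comment> \<open>No transition has an empty body, so dropping the empty pieces loses
    none.\<close>
  have "[] \<notin> B" by (auto simp: B body_def)
  then have "set (parse_facts (encode A)) = (\<lambda>b. parse_fact (split_at Comma b)) ` B"
    by (auto simp: parse_facts_def field set_split B_def[symmetric])
  also have "\<dots> = trans_facts A"
    unfolding trans_facts_def B using parse by (auto simp: image_iff) (metis parse)+
  finally show "set (parse_facts (encode A)) = trans_facts A" .
qed

text \<open>Paths of the underlying pushdown system. The counter is dropped, and with it the
  requirement that it stay nonnegative; only the first and last nonzero signs of the updates are
  recorded.\<close>

inductive sign_reach :: "(nat, nat) c1pvass \<Rightarrow> nat \<Rightarrow> nat list \<Rightarrow> token \<Rightarrow> token \<Rightarrow> bool" for A where
  sign_init: "sign_reach A (init A) [bottom A] (Bit False) (Bit False)"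
| sign_step: "sign_reach A s \<alpha> a b \<Longrightarrow> trans A s t = Some (z, oper) \<Longrightarrow> stack_step oper \<alpha> \<beta> \<Longrightarrow>
    sign_reach A t \<beta> (nonzero_or a (sign_token z)) (nonzero_or (sign_token z) b)"

lemma nonzero_or_assoc: "nonzero_or (nonzero_or a b) c = nonzero_or a (nonzero_or b c)"
  by (simp add: nonzero_or_def)

lemma nonzero_or_zero [simp]: "nonzero_or (Bit False) a = a" "nonzero_or a (Bit False) = a"
  by (simp_all add: nonzero_or_def)

text \<open>\<open>[Hash]\<close> relates any two stacks: it forgets what has been pushed, and
  soundness only claims that some stack results.\<close>

definition op_effect :: "token list \<Rightarrow> nat list \<Rightarrow> nat list \<Rightarrow> bool" where
  "op_effect x \<alpha> \<beta> \<longleftrightarrow> x = [] \<and> \<beta> = \<alpha> \<or> (\<exists>k. x = PushMark # enc_nat k \<and> \<beta> = \<alpha> @ [k]) \<or>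
     (\<exists>k. x = PopMark # enc_nat k \<and> \<alpha> = \<beta> @ [k]) \<or> x = [Hash]"

lemma head_token_simps [simp]: "head_token [] = Bit False" "head_token (t # w) = t"
  by (simp_all add: head_token_def)

lemma op_effect_simps [simp]:
  "op_effect [] \<alpha> \<beta> \<longleftrightarrow> \<beta> = \<alpha>"
  "op_effect (PushMark # enc_nat k) \<alpha> \<beta> \<longleftrightarrow> \<beta> = \<alpha> @ [k]"
  "op_effect (PopMark # enc_nat k) \<alpha> \<beta> \<longleftrightarrow> \<alpha> = \<beta> @ [k]"
  "op_effect [Hash] \<alpha> \<beta>"
  by (auto simp: op_effect_def enc_nat_inject)

definition op_word :: "token list \<Rightarrow> bool" where
  "op_word x \<longleftrightarrow> x = [] \<or> x = [Hash] \<or> (\<exists>k. x = PushMark # enc_nat k \<or> x = PopMark # enc_nat k)"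

text \<open>A pop can only be performed on a suitable stack, while every other fact applies to all stacks.\<close>

definition sound_fact :: "(nat, nat) c1pvass \<Rightarrow> fact \<Rightarrow> bool" where
  "sound_fact A = (\<lambda>(p, q, x, c, d). op_word x \<and> (\<exists>s t. p = enc_nat s \<and> q = enc_nat t \<and>
     (\<forall>\<alpha> a b. sign_reach A s \<alpha> a b \<longrightarrow>
        (\<forall>\<beta>. head_token x = PopMark \<longrightarrow> op_effect x \<alpha> \<beta> \<longrightarrow>
           sign_reach A t \<beta> (nonzero_or a c) (nonzero_or d b)) \<and>
        (head_token x \<noteq> PopMark \<longrightarrow>
           (\<exists>\<beta>. op_effect x \<alpha> \<beta> \<and> sign_reach A t \<beta> (nonzero_or a c) (nonzero_or d b))))))"

lemma op_comp_empty [simp]: "op_comp [] y = [y]" "op_comp x [] = [x]"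
  by (simp_all add: op_comp_def)

lemma op_comp_cases:
  assumes "op_word x" "op_word y" "z \<in> set (op_comp x y)"
  obtains "x = []" "z = y" | "y = []" "z = x" | k where "x = PushMark # enc_nat k" "y = PopMark # enc_nat k" "z = []"
    | "head_token x \<noteq> PopMark" "head_token y \<noteq> PopMark" "z = [Hash]"
proof -
  consider "x = []" | "y = []" | "x \<noteq> []" "y \<noteq> []" by blast
  then show ?thesis
  proof cases
    case 3
    show ?thesis
    proof (cases "head_token y = PopMark")
      case True
      then obtain k where y: "y = PopMark # enc_nat k" using assms(2) 3 by (auto simp: op_word_def)
      have "head_token x = PushMark"
        by (rule ccontr) (use assms(3) 3 True in \<open>simp add: op_comp_def\<close>)
      then obtain j where x: "x = PushMark # enc_nat j" using assms(1) by (auto simp: op_word_def)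
      have "j = k" "z = []"
        using assms(3) by (cases "j = k"; simp add: op_comp_def x y enc_nat_inject)+
      then show ?thesis using that(3) x y by blast
    next
      case False
      have "head_token x \<noteq> PopMark"
        using assms(3) 3 by (cases "head_token x = PopMark") (simp_all add: op_comp_def)
      moreover from this have "z = [Hash]" using assms(3) 3 False by (simp add: op_comp_def)
      ultimately show ?thesis using that(4) False by blast
    qed
  qed (use that assms(3) in simp_all)
qed

lemma sound_fact_trans:
  assumes "f \<in> trans_facts A"
  shows "sound_fact A f"
proof -
  obtain s t z oper where f: "f = (enc_nat s, enc_nat t, enc_op oper, sign_token z, sign_token z)"
    and tr: "trans A s t = Some (z, oper)"
    using assms by (auto simp: trans_facts_def)
  show ?thesis
    unfolding f sound_fact_def prod.case
  proof (rule conjI, goal_cases)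
    case 1
    show ?case by (cases oper) (auto simp: op_word_def)
  next
    case 2
    show ?case
    proof (rule exI[of _ s], rule exI[of _ t], intro conjI refl allI impI)
      fix \<alpha> a b \<beta>
      assume r: "sign_reach A s \<alpha> a b" and "head_token (enc_op oper) = PopMark" "op_effect (enc_op oper) \<alpha> \<beta>"
      then show "sign_reach A t \<beta> (nonzero_or a (sign_token z)) (nonzero_or (sign_token z) b)"
        by (intro sign_step[OF r tr]) (cases oper; simp)
    next
      fix \<alpha> a b assume r: "sign_reach A s \<alpha> a b" and "head_token (enc_op oper) \<noteq> PopMark"
      then have "\<exists>\<beta>. op_effect (enc_op oper) \<alpha> \<beta> \<and> stack_step oper \<alpha> \<beta>" by (cases oper) auto
      then show "\<exists>\<beta>. op_effect (enc_op oper) \<alpha> \<beta> \<and>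
          sign_reach A t \<beta> (nonzero_or a (sign_token z)) (nonzero_or (sign_token z) b)"
        using sign_step[OF r tr] by blast
    qed
  qed
qed

text \<open>A fact that is not a pop applies to every stack, so after forgotten pushes it is enough
  that some intermediate stack exists. A pop is composed only after the empty effect or after the
  push of the same symbol, where the stack is known.\<close>

lemma sound_fact_comp:
  assumes "sound_fact A f" "sound_fact A g" "h \<in> set (fact_comp f g)"
  shows "sound_fact A h"
proof -
  obtain s t x c d where f: "f = (enc_nat s, enc_nat t, x, c, d)" and x: "op_word x"
    and fpop: "\<And>\<alpha> a b \<beta>. sign_reach A s \<alpha> a b \<Longrightarrow> head_token x = PopMark \<Longrightarrow> op_effect x \<alpha> \<beta> \<Longrightarrow>
           sign_reach A t \<beta> (nonzero_or a c) (nonzero_or d b)"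
    and fother: "\<And>\<alpha> a b. sign_reach A s \<alpha> a b \<Longrightarrow> head_token x \<noteq> PopMark \<Longrightarrow>
           \<exists>\<beta>. op_effect x \<alpha> \<beta> \<and> sign_reach A t \<beta> (nonzero_or a c) (nonzero_or d b)"
    using assms(1) unfolding sound_fact_def by (cases f) blast
  obtain t' u y c' d' where g: "g = (enc_nat t', enc_nat u, y, c', d')" and y: "op_word y"
    and gpop: "\<And>\<alpha> a b \<beta>. sign_reach A t' \<alpha> a b \<Longrightarrow> head_token y = PopMark \<Longrightarrow> op_effect y \<alpha> \<beta> \<Longrightarrow>
           sign_reach A u \<beta> (nonzero_or a c') (nonzero_or d' b)"
    and gother: "\<And>\<alpha> a b. sign_reach A t' \<alpha> a b \<Longrightarrow> head_token y \<noteq> PopMark \<Longrightarrow>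
           \<exists>\<beta>. op_effect y \<alpha> \<beta> \<and> sign_reach A u \<beta> (nonzero_or a c') (nonzero_or d' b)"
    using assms(2) unfolding sound_fact_def by (cases g) blast
  obtain z where t': "t' = t" and z: "z \<in> set (op_comp x y)"
    and h: "h = (enc_nat s, enc_nat u, z, nonzero_or c c', nonzero_or d' d)"
    using assms(3) by (auto simp: fact_comp_def f g enc_nat_inject split: if_splits)
  have zword: "op_word z" using op_comp_mem[of x y] z x y by (auto simp: op_word_def)
  have "(\<forall>\<beta>. head_token z = PopMark \<longrightarrow> op_effect z \<alpha> \<beta> \<longrightarrow>
      sign_reach A u \<beta> (nonzero_or (nonzero_or a c) c') (nonzero_or d' (nonzero_or d b))) \<and>
    (head_token z \<noteq> PopMark \<longrightarrow> (\<exists>\<beta>. op_effect z \<alpha> \<beta> \<and>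
      sign_reach A u \<beta> (nonzero_or (nonzero_or a c) c') (nonzero_or d' (nonzero_or d b))))"
    if r: "sign_reach A s \<alpha> a b" for \<alpha> a b
    using x y z
  proof (cases rule: op_comp_cases)
    case 1
    then have "sign_reach A t \<alpha> (nonzero_or a c) (nonzero_or d b)" using fother[OF r] by auto
    then show ?thesis using gpop gother 1 t' by blast
  next
    case 2
    show ?thesis
    proof (intro conjI allI impI)
      fix \<beta> assume "head_token z = PopMark" "op_effect z \<alpha> \<beta>"
      then have "sign_reach A t \<beta> (nonzero_or a c) (nonzero_or d b)" using fpop[OF r] 2 by auto
      then show "sign_reach A u \<beta> (nonzero_or (nonzero_or a c) c') (nonzero_or d' (nonzero_or d b))"
        using gother[of \<beta>] 2 t' by auto
    next
      assume "head_token z \<noteq> PopMark"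
      then obtain \<beta> where "op_effect z \<alpha> \<beta>" "sign_reach A t \<beta> (nonzero_or a c) (nonzero_or d b)"
        using fother[OF r] 2 by auto
      then show "\<exists>\<beta>. op_effect z \<alpha> \<beta> \<and>
          sign_reach A u \<beta> (nonzero_or (nonzero_or a c) c') (nonzero_or d' (nonzero_or d b))"
        using gother[of \<beta>] 2 t' by auto
    qed
  next
    case (3 k)
    then have "sign_reach A t (\<alpha> @ [k]) (nonzero_or a c) (nonzero_or d b)" using fother[OF r] by auto
    then show ?thesis using gpop[of "\<alpha> @ [k]" _ _ \<alpha>] 3 t' by auto
  next
    case 4
    then obtain \<beta> where "sign_reach A t \<beta> (nonzero_or a c) (nonzero_or d b)" using fother[OF r] by auto
    then show ?thesis using gother[of \<beta>] 4 t' by auto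
  qed
  then show ?thesis
    unfolding h sound_fact_def prod.case using zword by (auto simp: nonzero_or_assoc)
qed

lemma sound_fact_closure: "f \<in> fact_closure (trans_facts A) \<Longrightarrow> sound_fact A f"
  by (induction rule: fact_closure.induct) (auto intro: sound_fact_trans sound_fact_comp)

text \<open>\<open>chain A \<gamma> s a b\<close>: above the bottom symbol, each symbol of the stack \<open>\<gamma>\<close> has been pushed by a
  derived push fact, and these facts link up to a path from the initial state to \<open>s\<close>.\<close>

inductive chain :: "(nat, nat) c1pvass \<Rightarrow> nat list \<Rightarrow> nat \<Rightarrow> token \<Rightarrow> token \<Rightarrow> bool" for A where
  chain_init: "chain A [] (init A) (Bit False) (Bit False)"
| chain_base: "(enc_nat (init A), enc_nat s, [], a, b) \<in> fact_closure (trans_facts A) \<Longrightarrow> chain A [] s a b"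
| chain_push: "chain A \<gamma> r a b \<Longrightarrow>
    (enc_nat r, enc_nat s, PushMark # enc_nat k, c, d) \<in> fact_closure (trans_facts A) \<Longrightarrow>
    chain A (\<gamma> @ [k]) s (nonzero_or a c) (nonzero_or d b)"

section \<open>Completeness of the derived facts\<close>

lemma fact_closure_comp:
  assumes "(p, q, x, a, b) \<in> fact_closure T" "(q, r, y, c, d) \<in> fact_closure T" "z \<in> set (op_comp x y)"
  shows "(p, r, z, nonzero_or a c, nonzero_or d b) \<in> fact_closure T"
  using assms(3) by (intro fact_closure.comp[OF assms(1,2)]) (auto simp: fact_comp_def)

text \<open>The balanced fact is merged into the last link, so the top symbol is still accounted for
  by a single push fact, ready to be cancelled by a pop.\<close>

lemma chain_absorb:
  assumes "chain A \<gamma> r a b" "(enc_nat r, enc_nat s, [], c, d) \<in> fact_closure (trans_facts A)"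
  shows "chain A \<gamma> s (nonzero_or a c) (nonzero_or d b)"
  using assms(1)
proof cases
  case chain_init
  then show ?thesis using assms(2) by (auto intro: chain_base)
next
  case chain_base
  have "(enc_nat (init A), enc_nat s, [], nonzero_or a c, nonzero_or d b) \<in> fact_closure (trans_facts A)"
    by (rule fact_closure_comp[OF chain_base(2) assms(2)]) (simp add: op_comp_def)
  then show ?thesis using chain_base(1) by (auto intro: chain.chain_base)
next
  case (chain_push \<gamma>' r' a' b' k c' d')
  have "(enc_nat r', enc_nat s, PushMark # enc_nat k, nonzero_or c' c, nonzero_or d d') \<in> fact_closure (trans_facts A)"
    by (rule fact_closure_comp[OF chain_push(5) assms(2)]) (simp add: op_comp_def)
  from chain.chain_push[OF chain_push(4) this] show ?thesis
    by (simp add: chain_push nonzero_or_assoc)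
qed

text \<open>A push adds a link. A pop composes with the last link to a balanced fact, which the
  chain below absorbs. So no composition other than those of \<open>op_comp\<close> is ever called
  for.\<close>

lemma sign_reach_chain:
  assumes "wf_c1pvass A" "sign_reach A s \<alpha> a b"
  shows "\<exists>\<gamma>. \<alpha> = bottom A # \<gamma> \<and> chain A \<gamma> s a b"
  using assms(2)
proof (induction rule: sign_reach.induct)
  case sign_init
  show ?case using chain_init by auto
next
  case (sign_step s \<alpha> a b t z oper \<beta>)
  then obtain \<gamma> where \<alpha>: "\<alpha> = bottom A # \<gamma>" and ch: "chain A \<gamma> s a b" by blast
  have fact: "(enc_nat s, enc_nat t, enc_op oper, sign_token z, sign_token z) \<in> fact_closure (trans_facts A)"
    using sign_step.hyps by (intro fact_closure.base) (auto simp: trans_facts_def)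
  show ?case
  proof (cases oper)
    case NoOp
    then show ?thesis using chain_absorb[OF ch] fact sign_step.hyps \<alpha> by auto
  next
    case (Push k)
    then show ?thesis using chain_push[OF ch] fact sign_step.hyps \<alpha> by auto
  next
    case (Pop k)
    \<comment> \<open>The bottom symbol is never popped, so the popped symbol lies in
      \<open>\<gamma>\<close> and belongs to the last link.\<close>
    have "k \<noteq> bottom A" using assms(1) sign_step.hyps(2) Pop by (fastforce simp: wf_c1pvass_def)
    moreover have "bottom A # \<gamma> = \<beta> @ [k]" using sign_step.hyps(3) \<alpha> Pop by simp
    ultimately obtain \<gamma>' where \<gamma>: "\<gamma> = \<gamma>' @ [k]" and \<beta>: "\<beta> = bottom A # \<gamma>'" by (cases \<beta>) auto
    from ch obtain r a' b' c d where ch': "chain A \<gamma>' r a' b'" and ab: "a = nonzero_or a' c" "b = nonzero_or d b'"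
      and push: "(enc_nat r, enc_nat s, PushMark # enc_nat k, c, d) \<in> fact_closure (trans_facts A)"
      unfolding \<gamma> by cases auto
    have "(enc_nat r, enc_nat t, [], nonzero_or c (sign_token z), nonzero_or (sign_token z) d) \<in> fact_closure (trans_facts A)"
      using fact Pop by (intro fact_closure_comp[OF push]) (auto simp: op_comp_def)
    from chain_absorb[OF ch' this] show ?thesis using \<beta> by (simp add: ab nonzero_or_assoc)
  qed
qed

lemma chain_fact:
  assumes "chain A \<gamma> s a b"
  shows "s = init A \<and> a = Bit False \<and> b = Bit False \<or>
    (\<exists>x. (enc_nat (init A), enc_nat s, x, a, b) \<in> fact_closure (trans_facts A) \<and> head_token x \<noteq> PopMark)"
  using assms
proof (induction rule: chain.induct)
  case chain_init
  then show ?case by simp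
next
  case (chain_base s a b)
  then show ?case by (intro disjI2 exI[of _ "[]"]) simp
next
  case (chain_push \<gamma> r a b s k c d)
  from chain_push.IH show ?case
  proof (elim disjE exE conjE)
    assume "r = init A" "a = Bit False" "b = Bit False"
    then show ?thesis using chain_push.hyps by (intro disjI2 exI[of _ "PushMark # enc_nat k"]) simp
  next
    fix x assume x: "(enc_nat (init A), enc_nat r, x, a, b) \<in> fact_closure (trans_facts A)" "head_token x \<noteq> PopMark"
    \<comment> \<open>Only now, when no link will be popped any more, are the pushes merged: a
      single one keeps its symbol, several become \<open>[Hash]\<close>.\<close>
    define y where "y = (if x = [] then PushMark # enc_nat k else [Hash])"
    have "y \<in> set (op_comp x (PushMark # enc_nat k))" using x(2) by (simp add: y_def op_comp_def)
    from fact_closure_comp[OF x(1) chain_push.hyps(2) this] show ?thesis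
      by (intro disjI2 exI[of _ y]) (simp add: y_def)
  qed
qed

theorem answer_encode:
  assumes "zero_c1pvass A" and ok: "(Bit False, Bit False) \<in> set ok"
  shows "answer ok (encode A) \<longleftrightarrow> (\<exists>\<alpha> a b. sign_reach A (final A) \<alpha> a b \<and> (a, b) \<in> set ok)"
proof -
  have wf: "wf_c1pvass A" using assms by (simp add: zero_c1pvass_def)
  have "answer ok (encode A) \<longleftrightarrow> init A = final A \<or> (\<exists>x a b.
      (enc_nat (init A), enc_nat (final A), x, a, b) \<in> fact_closure (trans_facts A) \<and> head_token x \<noteq> PopMark \<and>
      (a, b) \<in> set ok)"
    unfolding answer_def set_saturate set_parse_facts[OF assms(1)] enc_nat_inject Bex_def by auto
  also have "\<dots> \<longleftrightarrow> (\<exists>\<alpha> a b. sign_reach A (final A) \<alpha> a b \<and> (a, b) \<in> set ok)"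
  proof
    assume "init A = final A \<or> (\<exists>x a b.
      (enc_nat (init A), enc_nat (final A), x, a, b) \<in> fact_closure (trans_facts A) \<and> head_token x \<noteq> PopMark \<and>
      (a, b) \<in> set ok)"
    then show "\<exists>\<alpha> a b. sign_reach A (final A) \<alpha> a b \<and> (a, b) \<in> set ok"
    proof (elim disjE exE conjE)
      assume "init A = final A"
      then show ?thesis using sign_init[of A] ok by auto
    next
      fix x a b assume f: "(enc_nat (init A), enc_nat (final A), x, a, b) \<in> fact_closure (trans_facts A)"
        "head_token x \<noteq> PopMark" "(a, b) \<in> set ok"
      from sound_fact_closure[OF f(1)] obtain \<beta> where "sign_reach A (final A) \<beta> a b"
        using sign_init[of A] f(2) by (fastforce simp: sound_fact_def enc_nat_inject)
      then show ?thesis using f(3) by blast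
    qed
  next
    assume "\<exists>\<alpha> a b. sign_reach A (final A) \<alpha> a b \<and> (a, b) \<in> set ok"
    then obtain \<alpha> a b where r: "sign_reach A (final A) \<alpha> a b" "(a, b) \<in> set ok" by blast
    from sign_reach_chain[OF wf r(1)] obtain \<gamma> where "chain A \<gamma> (final A) a b" by blast
    from chain_fact[OF this] r(2) show "init A = final A \<or> (\<exists>x a b.
      (enc_nat (init A), enc_nat (final A), x, a, b) \<in> fact_closure (trans_facts A) \<and> head_token x \<noteq> PopMark \<and>
      (a, b) \<in> set ok)" by metis
  qed
  finally show ?thesis .
qed

section \<open>Signed paths and runs\<close>

inductive config_reach :: "('s, 'g) c1pvass \<Rightarrow> ('s, 'g) config \<Rightarrow> bool" for A where
  reach_init: "is_config A (init_config A) \<Longrightarrow> config_reach A (init_config A)"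
| reach_step: "config_reach A q \<Longrightarrow> config_step A q q' \<Longrightarrow> is_config A q' \<Longrightarrow> config_reach A q'"

lemma is_run_snoc:
  assumes "\<rho> \<noteq> []"
  shows "is_run A (\<rho> @ [q]) \<longleftrightarrow> is_run A \<rho> \<and> config_step A (last \<rho>) q \<and> is_config A q"
proof -
  have "(\<forall>i. Suc i < length (\<rho> @ [q]) \<longrightarrow> config_step A ((\<rho> @ [q]) ! i) ((\<rho> @ [q]) ! Suc i)) \<longleftrightarrow>
    (\<forall>i. Suc i < length \<rho> \<longrightarrow> config_step A (\<rho> ! i) (\<rho> ! Suc i)) \<and> config_step A (last \<rho>) q"
    (is "?L \<longleftrightarrow> ?R")
  proof
    assume L: ?L
    have "config_step A (\<rho> ! i) (\<rho> ! Suc i)" if "Suc i < length \<rho>" for i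
      using L[rule_format, of i] that by (simp add: nth_append)
    moreover have "config_step A (last \<rho>) q"
      using L[rule_format, of "length \<rho> - 1"] assms by (simp add: nth_append last_conv_nth)
    ultimately show ?R by blast
  next
    assume R: ?R
    show ?L
    proof (intro allI impI)
      fix i assume "Suc i < length (\<rho> @ [q])"
      then consider "Suc i < length \<rho>" | "i = length \<rho> - 1" "Suc i = length \<rho>" by fastforce
      then show "config_step A ((\<rho> @ [q]) ! i) ((\<rho> @ [q]) ! Suc i)"
        using R assms by cases (auto simp: nth_append last_conv_nth)
    qed
  qed
  then show ?thesis using assms by (auto simp: is_run_def)
qed

lemma config_reach_iff: "config_reach A q \<longleftrightarrow> (\<exists>\<rho>. is_run A \<rho> \<and> last \<rho> = q)"
proof
  assume "config_reach A q"
  then show "\<exists>\<rho>. is_run A \<rho> \<and> last \<rho> = q"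
  proof induction
    case reach_init
    then show ?case by (intro exI[of _ "[init_config A]"]) (simp add: is_run_def)
  next
    case (reach_step q q')
    then obtain \<rho> where "is_run A \<rho>" "last \<rho> = q" by blast
    moreover from this have "\<rho> \<noteq> []" by (simp add: is_run_def)
    ultimately show ?case using reach_step.hyps is_run_snoc[of \<rho> A q'] by (intro exI[of _ "\<rho> @ [q']"]) simp
  qed
next
  assume "\<exists>\<rho>. is_run A \<rho> \<and> last \<rho> = q"
  then obtain \<rho> where "is_run A \<rho>" "last \<rho> = q" by blast
  then show "config_reach A q"
  proof (induction \<rho> arbitrary: q rule: rev_induct)
    case (snoc q' \<rho>)
    show ?case
    proof (cases "\<rho> = []")
      case True
      then show ?thesis using snoc.prems reach_init[of A] by (auto simp: is_run_def)
    next
      case False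
      then show ?thesis using snoc.prems snoc.IH[of "last \<rho>"] is_run_snoc[OF False, of A q']
        by (auto intro: reach_step)
    qed
  qed (simp add: is_run_def)
qed

lemma config_reach_config: "config_reach A q \<Longrightarrow> is_config A q"
  by (induction rule: config_reach.induct)

lemma config_reach_next:
  assumes A: "zero_c1pvass A" and r: "config_reach A (s, \<alpha>, c)"
    and tr: "trans A s t = Some (z, oper)" and st: "stack_step oper \<alpha> \<beta>"
    and g: "0 < g" "g \<le> 1" and c': "c' = c + g * of_int z" "0 \<le> c'"
  shows "config_reach A (t, \<beta>, c')"
proof (rule reach_step[OF r])
  show "config_step A (s, \<alpha>, c) (t, \<beta>, c')"
    using tr st g c' by (auto simp: config_step_def)
  have "wf_c1pvass A" using A by (simp add: zero_c1pvass_def)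
  then have t: "t \<in> states A" "set_stack_op oper \<subseteq> stack_alphabet A"
    using tr unfolding wf_c1pvass_def by blast+
  moreover have "set \<alpha> \<subseteq> stack_alphabet A"
    using config_reach_config[OF r] by (auto simp: is_config_def)
  then have "set \<beta> \<subseteq> stack_alphabet A" using st t(2) by (cases oper) auto
  moreover have "guard A t = 0" using A t(1) by (auto simp: zero_c1pvass_def)
  ultimately show "is_config A (t, \<beta>, c')" using c'(2) by (auto simp: is_config_def)
qed

text \<open>The counter starts at 0 and may not become negative, so the first nonzero update is
  positive. If the last nonzero update is positive as well, the counter is positive after it and
  zero updates leave it so; hence ending at 0 requires a final negative sign.\<close>

lemma config_reach_sign:
  assumes "config_reach A q"
  shows "\<exists>a b. sign_reach A (fst q) (fst (snd q)) a b \<and>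
    (a = Bit False \<and> b = Bit False \<and> snd (snd q) = 0 \<or>
     a = Bit True \<and> (b = Bit True \<and> 0 < snd (snd q) \<or> b = Minus))"
  using assms
proof (induction rule: config_reach.induct)
  case reach_init
  show ?case using sign_init[of A] by (auto simp: init_config_def)
next
  case (reach_step q q')
  obtain s \<alpha> c where q: "q = (s, \<alpha>, c)" by (cases q)
  obtain t \<beta> c' where q': "q' = (t, \<beta>, c')" by (cases q')
  obtain a b where r: "sign_reach A s \<alpha> a b" and ab: "a = Bit False \<and> b = Bit False \<and> c = 0 \<or>
     a = Bit True \<and> (b = Bit True \<and> 0 < c \<or> b = Minus)"
    using reach_step.IH by (auto simp: q)
  obtain z oper g where tr: "trans A s t = Some (z, oper)" "stack_step oper \<alpha> \<beta>"
    and g: "0 < g" "c' = c + g * real_of_int z"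
    using reach_step.hyps(2) by (auto simp: config_step_def q q')
  have c: "0 \<le> c" "0 \<le> c'"
    using config_reach_config[OF reach_step.hyps(1)] reach_step.hyps(3) by (auto simp: is_config_def q q')
  have "nonzero_or a (sign_token z) = Bit False \<and> nonzero_or (sign_token z) b = Bit False \<and> c' = 0 \<or>
     nonzero_or a (sign_token z) = Bit True \<and>
     (nonzero_or (sign_token z) b = Bit True \<and> 0 < c' \<or> nonzero_or (sign_token z) b = Minus)"
  proof (cases "z = 0")
    case True
    then show ?thesis using ab g by (auto simp: sign_token_def)
  next
    case False
    show ?thesis
    proof (cases "0 < z")
      case True
      then have "0 < c'" using g c by (simp add: add_nonneg_pos)
      then show ?thesis using ab True by (auto simp: sign_token_def nonzero_or_def)
    next
      case neg: False
      then have "g * real_of_int z < 0" using g False by (simp add: mult_pos_neg)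
      \<comment> \<open>From counter 0 this decrement would lead below 0; so a positive update has
        come before.\<close>
      then have "c \<noteq> 0" using c g by auto
      then show ?thesis using ab neg False by (auto simp: sign_token_def nonzero_or_def)
    qed
  qed
  then show ?case using sign_step[OF r tr] by (auto simp: q')
qed

text \<open>The claim carries more than the value 0: to continue, a path also needs some reachable
  value strictly between 0 and 1. Updates are integers, so a decrement has size at least 1 and can
  be scaled to remove any nonzero part of such a value, or all of it.\<close>

lemma sign_config_reach:
  assumes A: "zero_c1pvass A" and "sign_reach A s \<alpha> a b"
  shows "(a = Bit False \<longrightarrow> b = Bit False \<and> config_reach A (s, \<alpha>, 0)) \<and>
    (a = Bit True \<longrightarrow> (\<exists>c. 0 < c \<and> c < 1 \<and> config_reach A (s, \<alpha>, c)) \<and>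
       (b = Minus \<longrightarrow> config_reach A (s, \<alpha>, 0)))"
  using assms(2)
proof (induction rule: sign_reach.induct)
  case sign_init
  have "is_config A (init_config A)"
    using A by (auto simp: zero_c1pvass_def wf_c1pvass_def is_config_def init_config_def)
  from reach_init[OF this] show ?case by (simp add: init_config_def)
next
  case (sign_step s \<alpha> a b t z oper \<beta>)
  note move = config_reach_next[OF A _ sign_step.hyps(2,3)]
  consider "z = 0" | "0 < z" | "z < 0" by linarith
  then show ?case
  proof cases
    case 1
    have "config_reach A (t, \<beta>, c)" if "config_reach A (s, \<alpha>, c)" for c
      using that config_reach_config[OF that] by (intro move[OF that, of 1]) (auto simp: 1 is_config_def)
    then show ?thesis using sign_step.IH by (auto simp: 1 sign_token_def)
  next
    case 2
    have "\<exists>c. 0 < c \<and> c < 1 \<and> config_reach A (t, \<beta>, c)" if "config_reach A (s, \<alpha>, c)" "0 \<le> c" "c < 1" for c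
    proof (intro exI conjI)
      \<comment> \<open>This factor leads from \<open>c\<close> to the midpoint of \<open>c\<close>
        and 1.\<close>
      let ?g = "(1 - c) / (2 * real_of_int z)"
      have "1 - c \<le> 2 * real_of_int z" using 2 that by linarith
      then show "config_reach A (t, \<beta>, (1 + c) / 2)"
        using that 2 by (intro move[OF that(1), of ?g]) (auto simp: field_simps)
    qed (use that in auto)
    note move' = this
    show ?thesis
    proof (cases "a = Bit False")
      case True
      then show ?thesis using move'[of 0] sign_step.IH 2 by (simp add: sign_token_def nonzero_or_def)
    next
      case False
      then show ?thesis using move' sign_step.IH 2 less_imp_le by (auto simp: sign_token_def nonzero_or_def)
    qed
  next
    case 3
    \<comment> \<open>Two choices of the factor are needed: halving the counter keeps it positive
      for the rest of the path, and removing all of it gives the run that ends at 0.\<close>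
    have "config_reach A (t, \<beta>, c / 2) \<and> config_reach A (t, \<beta>, 0)"
      if "config_reach A (s, \<alpha>, c)" "0 < c" "c < 1" for c
    proof
      have z: "real_of_int z \<le> - 1" using 3 by linarith
      show "config_reach A (t, \<beta>, c / 2)"
        using that 3 z by (intro move[OF that(1), of "c / (2 * - real_of_int z)"]) (auto simp: field_simps)
      show "config_reach A (t, \<beta>, 0)"
        using that 3 z by (intro move[OF that(1), of "c / (- real_of_int z)"]) (auto simp: field_simps)
    qed
    note move' = this
    show ?thesis
    proof (cases "a = Bit True")
      case True
      then obtain c where "0 < c" "c < 1" "config_reach A (s, \<alpha>, c)" using sign_step.IH by blast
      then show ?thesis using move'[of c] True 3
        by (intro conjI impI exI[of _ "c / 2"]) (simp_all add: sign_token_def nonzero_or_def)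
    qed (use 3 in \<open>auto simp: sign_token_def nonzero_or_def\<close>)
  qed
qed

lemma reaching_iff_sign:
  assumes "zero_c1pvass A"
  shows "(\<exists>\<rho>. reaching A 0 \<rho>) \<longleftrightarrow>
    (\<exists>\<alpha> a b. sign_reach A (final A) \<alpha> a b \<and> (a, b) \<in> set [(Bit False, Bit False), (Bit True, Minus)])"
proof -
  have "(\<exists>\<rho>. reaching A 0 \<rho>) \<longleftrightarrow> (\<exists>\<alpha>. config_reach A (final A, \<alpha>, 0))"
    unfolding reaching_def config_reach_iff by (auto simp: case_prod_beta) (metis prod.collapse)
  also have "\<dots> \<longleftrightarrow>
    (\<exists>\<alpha> a b. sign_reach A (final A) \<alpha> a b \<and> (a, b) \<in> set [(Bit False, Bit False), (Bit True, Minus)])"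
  proof
    assume "\<exists>\<alpha>. config_reach A (final A, \<alpha>, 0)"
    then obtain \<alpha> where "config_reach A (final A, \<alpha>, 0)" by blast
    from config_reach_sign[OF this] obtain a b where "sign_reach A (final A) \<alpha> a b"
      "a = Bit False \<and> b = Bit False \<or> a = Bit True \<and> b = Minus" by auto
    then show "\<exists>\<alpha> a b. sign_reach A (final A) \<alpha> a b \<and> (a, b) \<in> set [(Bit False, Bit False), (Bit True, Minus)]"
      by (intro exI[of _ \<alpha>] exI[of _ a] exI[of _ b]) auto
  next
    assume "\<exists>\<alpha> a b. sign_reach A (final A) \<alpha> a b \<and> (a, b) \<in> set [(Bit False, Bit False), (Bit True, Minus)]"
    then show "\<exists>\<alpha>. config_reach A (final A, \<alpha>, 0)"
      by (auto dest!: sign_config_reach[OF assms])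
  qed
  finally show ?thesis .
qed

text \<open>Every configuration has a nonnegative counter, so covering 0 is plain reachability of
  the accepting state: the last sign is free once the first is positive.\<close>

lemma covering_iff_sign:
  assumes "zero_c1pvass A"
  shows "(\<exists>\<rho>. covering A 0 \<rho>) \<longleftrightarrow> (\<exists>\<alpha> a b. sign_reach A (final A) \<alpha> a b \<and>
    (a, b) \<in> set [(Bit False, Bit False), (Bit True, Minus), (Bit True, Bit True)])"
proof -
  have "(\<exists>\<rho>. covering A 0 \<rho>) \<longleftrightarrow> (\<exists>\<alpha> c. 0 \<le> c \<and> config_reach A (final A, \<alpha>, c))"
    unfolding covering_def config_reach_iff by (auto simp: case_prod_beta) (metis prod.collapse)
  also have "\<dots> \<longleftrightarrow> (\<exists>\<alpha> a b. sign_reach A (final A) \<alpha> a b \<and>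
    (a, b) \<in> set [(Bit False, Bit False), (Bit True, Minus), (Bit True, Bit True)])"
  proof
    assume "\<exists>\<alpha> c. 0 \<le> c \<and> config_reach A (final A, \<alpha>, c)"
    then obtain \<alpha> c where "config_reach A (final A, \<alpha>, c)" by blast
    from config_reach_sign[OF this] obtain a b where "sign_reach A (final A) \<alpha> a b"
      "a = Bit False \<and> b = Bit False \<or> a = Bit True \<and> (b = Bit True \<or> b = Minus)" by auto
    then show "\<exists>\<alpha> a b. sign_reach A (final A) \<alpha> a b \<and>
        (a, b) \<in> set [(Bit False, Bit False), (Bit True, Minus), (Bit True, Bit True)]"
      by (intro exI[of _ \<alpha>] exI[of _ a] exI[of _ b]) auto
  next
    assume "\<exists>\<alpha> a b. sign_reach A (final A) \<alpha> a b \<and>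
        (a, b) \<in> set [(Bit False, Bit False), (Bit True, Minus), (Bit True, Bit True)]"
    then obtain \<alpha> a b where r: "sign_reach A (final A) \<alpha> a b" and "a = Bit False \<or> a = Bit True"
      by auto
    then obtain c where "0 \<le> c" "config_reach A (final A, \<alpha>, c)"
      using sign_config_reach[OF assms r] less_imp_le by blast
    then show "\<exists>\<alpha> c. 0 \<le> c \<and> config_reach A (final A, \<alpha>, c)" by blast
  qed
  finally show ?thesis .
qed

theorem theorem3p4:
  "poly_time_decidable {A :: (nat, nat) c1pvass. zero_c1pvass A} encode
     (\<lambda>A. \<exists>\<rho>. reaching A 0 \<rho>) \<and>
   poly_time_decidable {A :: (nat, nat) c1pvass. zero_c1pvass A} encode
     (\<lambda>A. \<exists>\<rho>. covering A 0 \<rho>)"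
proof
  show "poly_time_decidable {A :: (nat, nat) c1pvass. zero_c1pvass A} encode (\<lambda>A. \<exists>\<rho>. reaching A 0 \<rho>)"
    by (rule polytime_imp_poly_time_decidable[OF polytime_answer])
      (simp only: rev_rev_ident mem_Collect_eq reaching_iff_sign, rule answer_encode, simp_all)
  show "poly_time_decidable {A :: (nat, nat) c1pvass. zero_c1pvass A} encode (\<lambda>A. \<exists>\<rho>. covering A 0 \<rho>)"
    by (rule polytime_imp_poly_time_decidable[OF polytime_answer])
      (simp only: rev_rev_ident mem_Collect_eq covering_iff_sign, rule answer_encode, simp_all)
qed

end
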